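(* Let $F$ be a real closed field. Then the ring $F[X,Y]/(X^2+Y^2+1)$ is a principal ideal domain that is not a Euclidean domain.
   Context: A formally real field is a field in which $-1$ is not a sum of squares (equivalently, a field that admits a total order making it an ordered field). A real closed field $F$ is a formally real field such that $F(\sqrt{-1}) = F[X]/(X^2+1)$ is algebraically closed. A Euclidean domain is an integral domain $R$ with a division algorithm, i.e. for which there is a function $\varphi : R\setminus\{0\} \to \mathbb{Z}_{\ge 0}$ such that for all $a,b\in R$ with $b\neq 0$ there exist $q,r\in R$ with $a = qb+r$ and either $r=0$ or $\varphi(r)<\varphi(b)$. *)

theory Defs
  imports "HOL-Algebra.Algebra"
begin

definition sum_of_squares :: "('a, 'b) ring_scheme \<Rightarrow> 'a \<Rightarrow> bool"
  where "sum_of_squares R s \<longleftrightarrow>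
    (\<exists>(n::nat) a. a \<in> {..<n} \<rightarrow> carrier R \<and> s = (\<Oplus>\<^bsub>R\<^esub>i\<in>{..<n}. a i \<otimes>\<^bsub>R\<^esub> a i))"

locale formally_real_field = field F for F (structure) +
  assumes minus_one_not_sum_of_squares: "\<not> sum_of_squares F (\<ominus> \<one>)"

text \<open>\<open>Rupt\<^bsub>F\<^esub> (carrier F) p\<close> is the quotient of \<open>F[X]\<close> by the principal ideal generated
  by \<open>p\<close>.\<close>

locale real_closed_field = formally_real_field +
  assumes adjoin_sqrt_minus_one_closed:
    "algebraically_closed
       (Rupt (carrier F) (X [^]\<^bsub>poly_ring F\<^esub> (2::nat) \<oplus>\<^bsub>poly_ring F\<^esub> \<one>\<^bsub>poly_ring F\<^esub>))"

text \<open>The library has no ring structure on multivariate polynomials, so \<open>F[X,Y]\<close> is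
  the iterated polynomial ring \<open>(F[X])[Y]\<close>: the first variable is the constant polynomial with value
  the variable of \<open>F[X]\<close>, the second one is the outer variable.\<close>

definition poly_ring2 :: "('a, 'b) ring_scheme \<Rightarrow> 'a list list ring"
  where "poly_ring2 F = poly_ring (poly_ring F)"

definition var1 :: "('a, 'b) ring_scheme \<Rightarrow> 'a list list"
  where "var1 F = ring.poly_of_const (poly_ring F) X\<^bsub>F\<^esub>"

definition var2 :: "('a, 'b) ring_scheme \<Rightarrow> 'a list list"
  where "var2 F = X\<^bsub>poly_ring F\<^esub>"

definition conic_poly :: "('a, 'b) ring_scheme \<Rightarrow> 'a list list"
  where "conic_poly F =
    var1 F [^]\<^bsub>poly_ring2 F\<^esub> (2::nat) \<oplus>\<^bsub>poly_ring2 F\<^esub>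
    var2 F [^]\<^bsub>poly_ring2 F\<^esub> (2::nat) \<oplus>\<^bsub>poly_ring2 F\<^esub> \<one>\<^bsub>poly_ring2 F\<^esub>"

definition conic_ring :: "('a, 'b) ring_scheme \<Rightarrow> 'a list list set ring"
  where "conic_ring F = poly_ring2 F Quot PIdl\<^bsub>poly_ring2 F\<^esub> (conic_poly F)"

end

theory Submission
  imports Defs "HOL-Decision_Procs.Algebra_Aux"
begin

text \<open>Write \<open>R\<close> for the ring \<open>F[X,Y]/(X\<^sup>2+Y\<^sup>2+1)\<close>, and \<open>x\<close>, \<open>y\<close> for the classes of the
variables. Over \<open>F[X]\<close> it is free with basis \<open>1, y\<close>, and the norm of \<open>a + b y\<close> is
\<open>a\<^sup>2 + b\<^sup>2 (1 + X\<^sup>2) = a\<^sup>2 + b\<^sup>2 + (X b)\<^sup>2\<close>, a sum of three squares in \<open>F[X]\<close>. Since \<open>F\<close> is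
formally real, leading coefficients in such a sum cannot cancel. Hence the norm vanishes only at
\<open>0\<close>, which makes \<open>R\<close> a domain, and it is constant only at constants, so that the units of \<open>R\<close>
are exactly the nonzero elements of \<open>F\<close>.

\<^bold>\<open>Not Euclidean.\<close> Suppose that \<open>R\<close> has a Euclidean function, and take a nonzero nonunit
\<open>b\<close> at which it is smallest. The remainder of any element modulo \<open>b\<close> is then zero or a unit,
hence lies in \<open>F\<close>. In particular \<open>x\<close> and \<open>y\<close> are congruent modulo \<open>b\<close> to some \<open>c, d\<close> in \<open>F\<close>, so \<open>b\<close>
divides \<open>c\<^sup>2 + d\<^sup>2 + 1\<close>. This is a nonzero element of \<open>F\<close>, so \<open>b\<close> is a unit after all.

\<^bold>\<open>Principal.\<close> Say that \<open>f\<close> forces principality if every ideal containing \<open>f\<close> is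
principal. If \<open>l\<close> is nonzero and generates a maximal ideal, and \<open>g\<close> forces principality, then so does
\<open>l g\<close>: an ideal containing \<open>l g\<close> either lies in \<open>(l)\<close>, and is \<open>l\<close> times an ideal containing \<open>g\<close>, or is
comaximal with \<open>l\<close>, and contains \<open>g\<close> itself. As every nonzero element of \<open>R\<close> divides its norm,
it suffices to treat the nonzero elements of \<open>F[X]\<close>. Because \<open>F(i)\<close> is algebraically
closed, a nonconstant polynomial over \<open>F\<close> has a factor \<open>X - s\<close> or \<open>(X - s)\<^sup>2 + t\<^sup>2\<close> with
\<open>t \<noteq> 0\<close>. The line \<open>x - s\<close> generates a maximal ideal, with residue field \<open>F(\<surd>(-1-s\<^sup>2))\<close>.
The quadratic splits in \<open>R\<close>, up to a unit, into two lines: \<open>j = (x - s)/t\<close> is a square root of \<open>-1\<close>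
modulo the quadratic, \<open>F(i)\<close> contains a square root \<open>m + n i\<close> of \<open>-1 - (s + t i)\<^sup>2\<close>, and the two
factors are \<open>y + (m + n j)\<close> and \<open>y - (m + n j)\<close>, each generating a maximal ideal with residue field \<open>F(i)\<close>.\<close>

lemma (in ring) eq_if_diff_eq_zero:
  assumes "x \<in> carrier R" "y \<in> carrier R" "x \<ominus> y = \<zero>"
  shows "x = y"
  using assms by (simp add: eq_diff0)

section \<open>Principality by splitting off maximal principal ideals\<close>

definition (in ring) forces_principal :: "'a \<Rightarrow> bool"
  where "forces_principal f \<longleftrightarrow>
    (\<forall>I. ideal I R \<longrightarrow> f \<in> I \<longrightarrow> (\<exists>a \<in> carrier R. I = PIdl a))"

text \<open>Comaximality with every element outside \<open>PIdl l\<close> says that \<open>PIdl l\<close> is a maximal ideal; the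
unit ideal is included.\<close>

definition (in ring) generates_maximal :: "'a \<Rightarrow> bool"
  where "generates_maximal l \<longleftrightarrow> l \<in> carrier R \<and>
    (\<forall>f \<in> carrier R. l divides f \<or> (\<exists>g \<in> carrier R. \<exists>r \<in> carrier R. f \<otimes> g \<oplus> l \<otimes> r = \<one>))"

lemma (in cring) forces_principal_factor:
  assumes "forces_principal (f \<otimes> g)" "g \<in> carrier R"
  shows "forces_principal f"
  using assms ideal.I_r_closed unfolding forces_principal_def by metis

lemma (in cring) forces_principal_one: "forces_principal \<one>"
  using ideal.one_imp_carrier genideal_one cgenideal_eq_genideal
  unfolding forces_principal_def by (metis one_closed)

lemma (in domain) principal_domainI:
  assumes "\<And>f. f \<in> carrier R \<Longrightarrow> f \<noteq> \<zero> \<Longrightarrow> forces_principal f"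
  shows "principal_domain R"
proof (unfold_locales)
  fix I assume I: "ideal I R"
  show "\<exists>a \<in> carrier R. I = PIdl a"
  proof (cases "I = {\<zero>}")
    case True
    moreover have "PIdl \<zero> = {\<zero>}"
      using cgenideal_eq_genideal genideal_zero by simp
    ultimately show ?thesis by blast
  next
    case False
    have "\<zero> \<in> I" "I \<subseteq> carrier R"
      using I by (auto simp: additive_subgroup.zero_closed ideal.axioms(1) additive_subgroup.a_subset)
    then obtain f where "f \<in> I" "f \<in> carrier R" "f \<noteq> \<zero>" using False by blast
    then show ?thesis using assms I unfolding forces_principal_def by blast
  qed
qed

text \<open>An ideal \<open>I\<close> containing \<open>l g\<close> either consists of multiples of \<open>l\<close>, and then \<open>I = l J\<close> for an ideal
\<open>J\<close> that contains \<open>g\<close>, or it contains some \<open>f\<close> with \<open>f u + l r = 1\<close>, and multiplying by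
\<open>g\<close> shows \<open>g \<in> I\<close>.\<close>

lemma (in domain) forces_principal_mult:
  assumes l: "generates_maximal l" "l \<noteq> \<zero>"
    and g: "forces_principal g" "g \<in> carrier R"
  shows "forces_principal (l \<otimes> g)"
  unfolding forces_principal_def
proof (intro allI impI)
  fix I assume I: "ideal I R" and lg: "l \<otimes> g \<in> I"
  interpret I: ideal I R by (rule I)
  have lR: "l \<in> carrier R" using l unfolding generates_maximal_def by simp
  show "\<exists>a \<in> carrier R. I = PIdl a"
  proof (cases "\<forall>f \<in> I. l divides f")
    case True
    \<comment> \<open>The ideal quotient of \<open>I\<close> by \<open>l\<close>.\<close>
    define J where "J = {h \<in> carrier R. l \<otimes> h \<in> I}"
    have "ideal J R"
    proof (rule idealI[OF ring_axioms])
      show "subgroup J (add_monoid R)"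
        by (rule add.subgroupI)
          (auto simp: J_def lR r_distr r_minus intro!: exI[of _ \<zero>])
    next
      fix a x assume ax: "a \<in> J" "x \<in> carrier R"
      then have "l \<otimes> (x \<otimes> a) = x \<otimes> (l \<otimes> a)" "l \<otimes> (a \<otimes> x) = (l \<otimes> a) \<otimes> x"
        using lR by (simp_all add: J_def m_ac)
      then show "x \<otimes> a \<in> J" "a \<otimes> x \<in> J"
        using ax I.I_l_closed I.I_r_closed unfolding J_def by auto
    qed
    moreover have "g \<in> J" using g lg by (simp add: J_def)
    ultimately obtain a where a: "a \<in> carrier R" "J = PIdl a"
      using g unfolding forces_principal_def by blast
    have "I = PIdl (l \<otimes> a)"
    proof
      show "I \<subseteq> PIdl (l \<otimes> a)"
      proof
        fix f assume f: "f \<in> I"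
        then obtain h where h: "h \<in> carrier R" "f = l \<otimes> h"
          using True unfolding factor_def by auto
        then have "h \<in> J" using f by (simp add: J_def)
        then obtain r where "r \<in> carrier R" "h = r \<otimes> a"
          using a unfolding cgenideal_def by auto
        then have "f = r \<otimes> (l \<otimes> a)" using h lR a by (simp add: m_lcomm)
        then show "f \<in> PIdl (l \<otimes> a)" using \<open>r \<in> carrier R\<close> unfolding cgenideal_def by auto
      qed
      have "a \<in> J" using a cgenideal_self by simp
      then show "PIdl (l \<otimes> a) \<subseteq> I"
        unfolding cgenideal_def J_def by (auto intro: I.I_l_closed)
    qed
    then show ?thesis using a lR by blast
  next
    case False
    then obtain f where f: "f \<in> I" "\<not> l divides f" by blast
    have fR: "f \<in> carrier R" using f I.a_Hcarr by blast
    obtain u r where ur: "u \<in> carrier R" "r \<in> carrier R" "f \<otimes> u \<oplus> l \<otimes> r = \<one>"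
      using l f fR unfolding generates_maximal_def by blast
    have "f \<otimes> (u \<otimes> g) \<oplus> (l \<otimes> g) \<otimes> r = (f \<otimes> u \<oplus> l \<otimes> r) \<otimes> g"
      using ur(1,2) fR lR g(2) by algebra
    then have "g = f \<otimes> (u \<otimes> g) \<oplus> (l \<otimes> g) \<otimes> r"
      using ur(3) g(2) by simp
    moreover have "f \<otimes> (u \<otimes> g) \<in> I" "(l \<otimes> g) \<otimes> r \<in> I"
      using f lg ur(1,2) g(2) by (auto intro: I.I_r_closed)
    ultimately have "g \<in> I" by (metis I.a_closed)
    then show ?thesis using g(1) I unfolding forces_principal_def by blast
  qed
qed

section \<open>Polynomials over a domain\<close>

context domain
begin

lemma X_closed [simp]: "X \<in> carrier (poly_ring R)"
  using var_closed(1)[OF carrier_is_subring] .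

lemma degree_const: "degree (poly_of_const s) = 0"
  by (simp add: poly_of_const_def)

lemma degree_X: "degree X = 1"
  by (simp add: var_def)

lemma degree_add_const:
  assumes "p \<in> carrier (poly_ring R)" "q \<in> carrier (poly_ring R)" "degree q = 0" 
  shows "degree (p \<oplus>\<^bsub>poly_ring R\<^esub> q) = degree p"
proof (cases "degree p = 0")
  case True
  then show ?thesis using poly_add_degree[of p q] assms by (simp add: univ_poly_add)
next
  case False
  then show ?thesis
    using poly_add_degree_eq[OF carrier_is_subring, of p q] assms
    by (simp add: univ_poly_add univ_poly_carrier)
qed

lemma degree_mult:
  assumes "p \<in> carrier (poly_ring R)" "q \<in> carrier (poly_ring R)" "p \<noteq> \<zero>\<^bsub>poly_ring R\<^esub>" "q \<noteq> \<zero>\<^bsub>poly_ring R\<^esub>"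
  shows "degree (p \<otimes>\<^bsub>poly_ring R\<^esub> q) = degree p + degree q"
  using poly_mult_degree_eq[OF carrier_is_subring, of p q] assms
  by (simp add: univ_poly_mult univ_poly_carrier univ_poly_zero)

lemma not_zero_if_degree: "degree p > 0 \<Longrightarrow> p \<noteq> \<zero>\<^bsub>poly_ring R\<^esub>"
  by (auto simp: univ_poly_zero)

lemma rupture_surj_self:
  assumes m: "m \<in> carrier (poly_ring R)"
  shows "rupture_surj (carrier R) m m = \<zero>\<^bsub>Rupt (carrier R) m\<^esub>"
proof -
  interpret UP: domain "poly_ring R" by (rule univ_poly_is_domain[OF carrier_is_subring])
  show ?thesis
    using UP.cgenideal_self[OF m] ideal.axioms(1)[OF UP.cgenideal_ideal[OF m]]
    unfolding rupture_def FactRing_def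
    by (simp add: abelian_subgroup.a_rcos_const abelian_subgroupI3 UP.is_abelian_group)
qed

lemma rupture_surj_eq_zeroD:
  assumes m: "m \<in> carrier (poly_ring R)" and p: "p \<in> carrier (poly_ring R)"
    and eq: "rupture_surj (carrier R) m p = \<zero>\<^bsub>Rupt (carrier R) m\<^esub>"
  shows "\<exists>q \<in> carrier (poly_ring R). p = q \<otimes>\<^bsub>poly_ring R\<^esub> m"
proof -
  interpret UP: domain "poly_ring R" by (rule univ_poly_is_domain[OF carrier_is_subring])
  interpret I: ideal "PIdl\<^bsub>poly_ring R\<^esub> m" "poly_ring R" by (rule UP.cgenideal_ideal[OF m])
  have "PIdl\<^bsub>poly_ring R\<^esub> m +>\<^bsub>poly_ring R\<^esub> p = PIdl\<^bsub>poly_ring R\<^esub> m"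
    using eq unfolding rupture_def FactRing_def by simp
  then have "p \<in> PIdl\<^bsub>poly_ring R\<^esub> m"
    using I.rcos_const_imp_mem p by blast
  then show ?thesis unfolding cgenideal_def by blast
qed

end

text \<open>The coefficient at twice a degree bound is a square even where the bound is not attained; this is
what allows comparing squares of polynomials of different degrees at a common exponent.\<close>

lemma (in domain) coeff_square:
  assumes p: "p \<in> carrier (poly_ring R)" and n: "degree p \<le> n"
  shows "coeff (p \<otimes>\<^bsub>poly_ring R\<^esub> p) (2 * n) = coeff p n \<otimes> coeff p n"
proof (cases "p = []")
  case True
  then show ?thesis by (simp add: univ_poly_mult)
next
  case False
  have pol: "polynomial (carrier R) p" using p by (simp add: univ_poly_carrier)
  show ?thesis
  proof (cases "degree p = n")
    case True
    then show ?thesis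
      using poly_mult_lead_coeff_aux[OF carrier_is_subring pol pol False False] lead_coeff_simp[OF False]
      by (simp add: univ_poly_mult mult_2)
  next
    case neq: False
    have "degree (p \<otimes>\<^bsub>poly_ring R\<^esub> p) < 2 * n"
      using poly_mult_degree_eq[OF carrier_is_subring pol pol] n neq
      unfolding univ_poly_mult by auto
    then show ?thesis using n neq by (simp add: coeff_degree)
  qed
qed

text \<open>Applying \<open>h\<close> to coefficients may destroy the normal form of a coefficient list, but evaluation
does not see leading zeros.\<close>

lemma (in ring_hom_ring) eval_map_is_hom:
  assumes "cring S" "a \<in> carrier S"
  shows "(\<lambda>p. S.eval (map h p) a) \<in> ring_hom (poly_ring R) S"
proof -
  interpret S': cring S by (rule assms(1))
  have set_map: "set (map h p) \<subseteq> carrier S" if "set p \<subseteq> carrier R" for p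
    using that by auto
  have pc: "set p \<subseteq> carrier R" if "p \<in> carrier (poly_ring R)" for p
    using that R.polynomial_in_carrier[OF R.carrier_is_subring] by (simp add: univ_poly_carrier)
  show ?thesis
  proof (rule ring_hom_memI)
    fix p q assume pq: "p \<in> carrier (poly_ring R)" "q \<in> carrier (poly_ring R)"
    show "S.eval (map h p) a \<in> carrier S"
      using S.eval_in_carrier set_map pc pq assms(2) by blast
    have "S.eval (map h (R.poly_mult p q)) a = S.eval (S.normalize (map h (R.poly_mult p q))) a"
      using S.eval_normalize set_map R.poly_mult_in_carrier pc pq assms(2) by metis
    then show "S.eval (map h (p \<otimes>\<^bsub>poly_ring R\<^esub> q)) a = S.eval (map h p) a \<otimes>\<^bsub>S\<^esub> S.eval (map h q) a"
      using poly_mult_hom'[of p q] S'.eval_poly_mult[OF set_map set_map assms(2), of p q] pc pq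
      by (simp add: univ_poly_mult)
    have "S.eval (map h (R.poly_add p q)) a = S.eval (S.normalize (map h (R.poly_add p q))) a"
      using S.eval_normalize set_map R.poly_add_in_carrier pc pq assms(2) by metis
    then show "S.eval (map h (p \<oplus>\<^bsub>poly_ring R\<^esub> q)) a = S.eval (map h p) a \<oplus>\<^bsub>S\<^esub> S.eval (map h q) a"
      using poly_add_hom'[of p q] S.eval_poly_add[OF set_map set_map assms(2), of p q] pc pq
      by (simp add: univ_poly_add)
  qed (use assms(2) in \<open>simp add: univ_poly_one\<close>)
qed

lemma (in algebraically_closed) exists_root:
  assumes "p \<in> carrier (poly_ring L)" "degree p > 0"
  shows "\<exists>x \<in> carrier L. eval p x = \<zero>"
proof -
  have "size (roots p) \<noteq> 0"
    using roots_over_carrier[OF assms(1)] assms(2) unfolding splitted_def by simp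
  then obtain x where "x \<in># roots p" by fastforce
  then show ?thesis using roots_mem_iff_is_root[OF assms(1)] unfolding is_root_def by blast
qed

lemma (in domain) length_le_2_linear:
  assumes p: "p \<in> carrier (poly_ring R)" and "length p \<le> 2"
  shows "\<exists>a \<in> carrier R. \<exists>b \<in> carrier R. p =
    poly_of_const a \<oplus>\<^bsub>poly_ring R\<^esub> poly_of_const b \<otimes>\<^bsub>poly_ring R\<^esub> X"
proof -
  interpret UP: domain "poly_ring R" by (rule univ_poly_is_domain[OF carrier_is_subring])
  interpret c: ring_hom_ring R "poly_ring R" poly_of_const
    using canonical_embedding_ring_hom[OF carrier_is_subring] by simp
  have X: "X \<in> carrier (poly_ring R)" using var_closed(1)[OF carrier_is_subring] .
  have pc: "set p \<subseteq> carrier R"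
    using p polynomial_in_carrier[OF carrier_is_subring] by (simp add: univ_poly_carrier)
  have p_eq: "p = UP.eval (map poly_of_const p) X"
    by (rule eval_rewrite[OF carrier_is_subring p])
  consider "p = []" | a where "p = [a]" | a b where "p = [b, a]"
    using assms(2) by (cases p; cases "tl p"; auto)
  then show ?thesis
  proof cases
    case 1
    then have "p = poly_of_const \<zero> \<oplus>\<^bsub>poly_ring R\<^esub> poly_of_const \<zero> \<otimes>\<^bsub>poly_ring R\<^esub> X"
      using X by (simp add: univ_poly_zero[symmetric])
    then show ?thesis by blast
  next
    case (2 a)
    have a: "a \<in> carrier R" using pc unfolding 2 by simp
    have "[a] = UP.eval (map poly_of_const [a]) X" using p_eq unfolding 2 .
    then have "p = poly_of_const a \<oplus>\<^bsub>poly_ring R\<^esub> poly_of_const \<zero> \<otimes>\<^bsub>poly_ring R\<^esub> X"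
      using X a unfolding 2 by simp
    then show ?thesis using a by blast
  next
    case (3 a b)
    have ab: "a \<in> carrier R" "b \<in> carrier R" using pc unfolding 3 by simp_all
    have "[b, a] = UP.eval (map poly_of_const [b, a]) X" using p_eq unfolding 3 .
    then have "p = poly_of_const a \<oplus>\<^bsub>poly_ring R\<^esub> poly_of_const b \<otimes>\<^bsub>poly_ring R\<^esub> X"
      using X ab unfolding 3 by (simp add: UP.a_comm)
    then show ?thesis using ab by blast
  qed
qed

section \<open>Sums of squares over a formally real field\<close>

context formally_real_field
begin

lemma two_squares_neq: 
  assumes "x \<in> carrier F" "y \<in> carrier F"
  shows "x \<otimes> x \<oplus> y \<otimes> y \<oplus> \<one> \<noteq> \<zero>"
proof
  assume eq: "x \<otimes> x \<oplus> y \<otimes> y \<oplus> \<one> = \<zero>"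
  define a where "a = (\<lambda>i::nat. if i = 0 then x else y)"
  have "a \<in> {..<2} \<rightarrow> carrier F" using assms by (auto simp: a_def)
  moreover have "(\<Oplus>i\<in>{..<2}. a i \<otimes> a i) = x \<otimes> x \<oplus> y \<otimes> y"
    using assms by (simp add: numeral_2_eq_2 lessThan_Suc a_def a_comm)
  moreover have "x \<otimes> x \<oplus> y \<otimes> y = \<ominus> \<one>"
    using eq assms by (simp add: minus_equality)
  ultimately show False
    using minus_one_not_sum_of_squares unfolding sum_of_squares_def by metis
qed

text \<open>Dividing by \<open>z\<^sup>2\<close> would write \<open>-1\<close> as a sum of two squares.\<close>

lemma three_squares_eq_zeroD:
  assumes "x \<in> carrier F" "y \<in> carrier F" "z \<in> carrier F"
    and eq: "x \<otimes> x \<oplus> y \<otimes> y \<oplus> z \<otimes> z = \<zero>"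
  shows "z = \<zero>"
proof (rule ccontr)
  assume nz: "z \<noteq> \<zero>"
  define w where "w = inv z"
  have w: "w \<in> carrier F" "z \<otimes> w = \<one>" using nz assms by (simp_all add: w_def)
  have "(x \<otimes> w) \<otimes> (x \<otimes> w) \<oplus> (y \<otimes> w) \<otimes> (y \<otimes> w) \<oplus> (z \<otimes> w) \<otimes> (z \<otimes> w)
      = (x \<otimes> x \<oplus> y \<otimes> y \<oplus> z \<otimes> z) \<otimes> (w \<otimes> w)"
    using assms(1-3) w(1) by algebra
  then have "(x \<otimes> w) \<otimes> (x \<otimes> w) \<oplus> (y \<otimes> w) \<otimes> (y \<otimes> w) \<oplus> \<one> = \<zero>"
    using eq w by simp
  then show False using two_squares_neq[of "x \<otimes> w" "y \<otimes> w"] assms w by simp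
qed

lemma three_squares_eq_zero:
  assumes "x \<in> carrier F" "y \<in> carrier F" "z \<in> carrier F"
    and eq: "x \<otimes> x \<oplus> y \<otimes> y \<oplus> z \<otimes> z = \<zero>"
  shows "x = \<zero> \<and> y = \<zero> \<and> z = \<zero>"
proof (intro conjI)
  show "x = \<zero>" by (rule three_squares_eq_zeroD[of y z]) (use assms in \<open>auto simp: a_ac\<close>)
  show "y = \<zero>" by (rule three_squares_eq_zeroD[of x z]) (use assms in \<open>auto simp: a_ac\<close>)
qed (rule three_squares_eq_zeroD[OF assms])

abbreviation P where "P \<equiv> poly_ring F"

lemma poly_carrier_set: "p \<in> carrier P \<Longrightarrow> set p \<subseteq> carrier F"
  using polynomial_in_carrier[OF carrier_is_subring] by (simp add: univ_poly_carrier)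

sublocale P: domain P
  by (rule univ_poly_is_domain[OF carrier_is_subring])

text \<open>At the exponent \<open>2 * n\<close> the sum of the three squares has as coefficient the sum of the squares of the
coefficients at \<open>n\<close>, so leading terms do not cancel.\<close>

lemma three_poly_squares_coeff_eq_zero:
  assumes p: "p \<in> carrier P" "q \<in> carrier P" "r \<in> carrier P"
    and n: "degree p \<le> n" "degree q \<le> n" "degree r \<le> n"
    and eq: "coeff (p \<otimes>\<^bsub>P\<^esub> p \<oplus>\<^bsub>P\<^esub> q \<otimes>\<^bsub>P\<^esub> q \<oplus>\<^bsub>P\<^esub> r \<otimes>\<^bsub>P\<^esub> r) (2 * n) = \<zero>"
  shows "coeff p n = \<zero> \<and> coeff q n = \<zero> \<and> coeff r n = \<zero>"
proof (rule three_squares_eq_zero)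
  have add: "coeff (a \<oplus>\<^bsub>P\<^esub> b) i = coeff a i \<oplus> coeff b i"
    if "a \<in> carrier P" "b \<in> carrier P" for a b i
    using poly_add_coeff[of a b] that by (simp add: poly_carrier_set univ_poly_add)
  show "coeff p n \<otimes> coeff p n \<oplus> coeff q n \<otimes> coeff q n \<oplus> coeff r n \<otimes> coeff r n = \<zero>"
    using eq p by (simp add: add coeff_square[OF p(1) n(1)] coeff_square[OF p(2) n(2)] coeff_square[OF p(3) n(3)])
qed (use p in \<open>auto simp: poly_carrier_set\<close>)

lemma three_poly_squares_eq_zero:
  assumes p: "p \<in> carrier P" "q \<in> carrier P" "r \<in> carrier P"
    and eq: "p \<otimes>\<^bsub>P\<^esub> p \<oplus>\<^bsub>P\<^esub> q \<otimes>\<^bsub>P\<^esub> q \<oplus>\<^bsub>P\<^esub> r \<otimes>\<^bsub>P\<^esub> r = \<zero>\<^bsub>P\<^esub>"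
  shows "p = \<zero>\<^bsub>P\<^esub> \<and> q = \<zero>\<^bsub>P\<^esub> \<and> r = \<zero>\<^bsub>P\<^esub>"
proof -
  have lc: "coeff a (degree a) \<noteq> \<zero>" if "a \<in> carrier P" "a \<noteq> []" for a
    using that lead_coeff_simp[of a] by (auto simp: univ_poly_carrier[symmetric] polynomial_def)
  have co: "coeff p n = \<zero> \<and> coeff q n = \<zero> \<and> coeff r n = \<zero>"
    if "degree p \<le> n" "degree q \<le> n" "degree r \<le> n" for n
    using three_poly_squares_coeff_eq_zero[OF p that] eq by (simp add: univ_poly_zero)
  define m where "m = max (degree p) (max (degree q) (degree r))"
  have le: "degree p \<le> m" "degree q \<le> m" "degree r \<le> m" by (simp_all add: m_def)
  have m: "degree p = m \<or> degree q = m \<or> degree r = m" by (auto simp: m_def max_def)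
  have nil: "a = []" if "a \<in> {p, q, r}" "degree a = m" for a
    using lc[of a] co[OF le] that p by auto
  then have "m = 0" using m by fastforce
  then show ?thesis
    using nil le by (simp add: univ_poly_zero)
qed

lemma three_poly_squares_const:
  assumes p: "p \<in> carrier P" "q \<in> carrier P" "r \<in> carrier P"
    and eq: "degree (p \<otimes>\<^bsub>P\<^esub> p \<oplus>\<^bsub>P\<^esub> q \<otimes>\<^bsub>P\<^esub> q \<oplus>\<^bsub>P\<^esub> r \<otimes>\<^bsub>P\<^esub> r) = 0"
  shows "degree p = 0 \<and> degree q = 0 \<and> degree r = 0"
proof -
  define m where "m = max (degree p) (max (degree q) (degree r))"
  have "m = 0"
  proof (rule ccontr)
    assume m: "m \<noteq> 0"
    have "coeff p m = \<zero> \<and> coeff q m = \<zero> \<and> coeff r m = \<zero>"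
      by (rule three_poly_squares_coeff_eq_zero[OF p]) (use m eq in \<open>auto simp: m_def coeff_degree\<close>)
    moreover have "coeff a (degree a) \<noteq> \<zero>" if "a \<in> carrier P" "degree a = m" for a
      using that lead_coeff_simp[of a] m
      by (cases a) (auto simp: univ_poly_carrier[symmetric] polynomial_def)
    moreover have "degree p = m \<or> degree q = m \<or> degree r = m" by (auto simp: m_def max_def)
    ultimately show False using p by metis
  qed
  then show ?thesis by (simp add: m_def)
qed

text \<open>Over a real closed field, the polynomials \<open>lin s\<close>, together with the polynomials \<open>quad s t\<close> for \<open>t \<noteq> 0\<close>, are
the monic irreducible ones.\<close>

abbreviation lin :: "'a \<Rightarrow> 'a list"
  where "lin s \<equiv> X \<ominus>\<^bsub>P\<^esub> poly_of_const s"

abbreviation quad :: "'a \<Rightarrow> 'a \<Rightarrow> 'a list"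
  where "quad s t \<equiv> lin s \<otimes>\<^bsub>P\<^esub> lin s \<oplus>\<^bsub>P\<^esub> poly_of_const t \<otimes>\<^bsub>P\<^esub> poly_of_const t"

sublocale const: ring_hom_ring F P poly_of_const
  using canonical_embedding_ring_hom[OF carrier_is_subring] by simp

lemma lin_closed: "s \<in> carrier F \<Longrightarrow> lin s \<in> carrier P"
  by simp

lemma degree_lin: 
  assumes "s \<in> carrier F"
  shows "degree (lin s) = 1"
proof -
  have "lin s = X \<oplus>\<^bsub>P\<^esub> poly_of_const (\<ominus> s)"
    using assms by (simp add: a_minus_def)
  also have "degree \<dots> = degree X"
    using assms by (intro degree_add_const X_closed const.hom_closed degree_const a_inv_closed)
  finally show ?thesis using degree_X by (rule trans)
qed

lemma degree_quad:
  assumes "s \<in> carrier F" "t \<in> carrier F"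
  shows "degree (quad s t) = 2"
proof -
  have lin: "lin s \<in> carrier P" "lin s \<noteq> \<zero>\<^bsub>P\<^esub>"
    using assms(1) degree_lin[OF assms(1)] by (auto simp: univ_poly_zero)
  have tt: "poly_of_const t \<otimes>\<^bsub>P\<^esub> poly_of_const t = poly_of_const (t \<otimes> t)"
    by (rule const.hom_mult[OF assms(2,2), symmetric])
  have "degree (quad s t) = degree (lin s \<otimes>\<^bsub>P\<^esub> lin s)"
    unfolding tt
    by (rule degree_add_const[OF P.m_closed[OF lin(1,1)] const.hom_closed[OF m_closed[OF assms(2,2)]] degree_const])
  moreover have "degree (lin s \<otimes>\<^bsub>P\<^esub> lin s) = degree (lin s) + degree (lin s)"
    by (rule degree_mult[OF lin(1,1,2,2)])
  ultimately show ?thesis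
    unfolding degree_lin[OF assms(1)] by linarith
qed

end

section \<open>Adjoining a square root of minus one\<close>

context real_closed_field
begin

text \<open>Presents \<open>F(i)\<close> through the coordinates \<open>a + b i\<close> of its elements, the form in which algebraic closedness is turned
into statements about \<open>F\<close>. Uniqueness of the coordinates comes from formal reality: \<open>a + b i = 0\<close> gives
\<open>a\<^sup>2 + b\<^sup>2 = (a + b i) (a - b i) = 0\<close>.\<close>

lemma adjoin_sqrt_minus_one:
  obtains C :: "'a list set ring" and \<iota> i where "algebraically_closed C"
    and "ring_hom_ring F C \<iota>" and "i \<in> carrier C" and "i \<otimes>\<^bsub>C\<^esub> i = \<ominus>\<^bsub>C\<^esub> \<one>\<^bsub>C\<^esub>"
    and "\<And>z. z \<in> carrier C \<Longrightarrow>
      \<exists>a \<in> carrier F. \<exists>b \<in> carrier F. z = \<iota> a \<oplus>\<^bsub>C\<^esub> \<iota> b \<otimes>\<^bsub>C\<^esub> i"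
    and "\<And>a b. \<lbrakk>a \<in> carrier F; b \<in> carrier F; \<iota> a \<oplus>\<^bsub>C\<^esub> \<iota> b \<otimes>\<^bsub>C\<^esub> i = \<zero>\<^bsub>C\<^esub>\<rbrakk>
      \<Longrightarrow> a = \<zero> \<and> b = \<zero>"
proof -
  define m where "m = X [^]\<^bsub>P\<^esub> (2::nat) \<oplus>\<^bsub>P\<^esub> \<one>\<^bsub>P\<^esub>"
  define C where "C = Rupt (carrier F) m"
  define h where "h = rupture_surj (carrier F) m"
  define \<iota> where "\<iota> = h \<circ> poly_of_const"
  have m: "m \<in> carrier P" by (simp add: m_def)
  have deg_m: "degree m = 2"
    using degree_add_const[OF P.nat_pow_closed[OF X_closed] P.one_closed, of 2]
      polynomial_pow_degree[OF X_closed, of 2] degree_X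
    by (simp add: m_def univ_poly_one)
  have C: "algebraically_closed C"
    using adjoin_sqrt_minus_one_closed by (simp add: C_def m_def)
  interpret C: algebraically_closed C by (rule C)
  interpret h: ring_hom_ring P C h
    unfolding C_def h_def by (rule rupture_surj_hom(2)[OF carrier_is_subring m])
  have hom: "ring_hom_ring F C \<iota>"
    by (rule ring_hom_ringI2[OF ring_axioms C.ring_axioms])
      (use ring_hom_trans[OF const.homh h.homh] in \<open>simp add: \<iota>_def\<close>)
  interpret \<iota>: ring_hom_ring F C \<iota> by (rule hom)
  have "h m = \<zero>\<^bsub>C\<^esub>"
    unfolding h_def C_def by (rule rupture_surj_self[OF m])
  then have "h X \<otimes>\<^bsub>C\<^esub> h X \<oplus>\<^bsub>C\<^esub> \<one>\<^bsub>C\<^esub> = \<zero>\<^bsub>C\<^esub>"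
    by (simp add: m_def numeral_2_eq_2)
  then have i: "h X \<otimes>\<^bsub>C\<^esub> h X = \<ominus>\<^bsub>C\<^esub> \<one>\<^bsub>C\<^esub>"
    by (simp add: C.minus_equality)
  have span: "\<exists>a \<in> carrier F. \<exists>b \<in> carrier F. z = \<iota> a \<oplus>\<^bsub>C\<^esub> \<iota> b \<otimes>\<^bsub>C\<^esub> h X"
    if z: "z \<in> carrier C" for z
  proof -
    obtain q where q: "q \<in> carrier P" "z = h (pmod q m)"
      using z rupture_carrier_as_pmod_image[OF carrier_is_subfield m] unfolding C_def h_def by auto
    have "m \<noteq> []" using deg_m by auto
    then have "length (pmod q m) \<le> 2"
      using pmod_degree[OF carrier_is_subfield q(1) m] deg_m by auto
    then obtain a b where "a \<in> carrier F" "b \<in> carrier F"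
      "pmod q m = poly_of_const a \<oplus>\<^bsub>P\<^esub> poly_of_const b \<otimes>\<^bsub>P\<^esub> X"
      using length_le_2_linear long_division_closed(2)[OF carrier_is_subfield q(1) m] by blast
    then show ?thesis using q(2) by (auto simp: \<iota>_def)
  qed
  have indep: "a = \<zero> \<and> b = \<zero>"
    if ab: "a \<in> carrier F" "b \<in> carrier F" and eq: "\<iota> a \<oplus>\<^bsub>C\<^esub> \<iota> b \<otimes>\<^bsub>C\<^esub> h X = \<zero>\<^bsub>C\<^esub>" for a b
  proof -
    define u v w where "u = \<iota> a" and "v = \<iota> b" and "w = h X"
    have [simp]: "u \<in> carrier C" "v \<in> carrier C" "w \<in> carrier C"
      using ab by (auto simp: u_def v_def w_def)
    have uC: "u \<in> carrier C" and vC: "v \<in> carrier C" and wC: "w \<in> carrier C" by simp_all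
    have uvw: "u \<oplus>\<^bsub>C\<^esub> v \<otimes>\<^bsub>C\<^esub> w = \<zero>\<^bsub>C\<^esub>" using eq by (simp add: u_def v_def w_def)
    have "(u \<oplus>\<^bsub>C\<^esub> v \<otimes>\<^bsub>C\<^esub> w) \<otimes>\<^bsub>C\<^esub> (u \<ominus>\<^bsub>C\<^esub> v \<otimes>\<^bsub>C\<^esub> w) =
        u \<otimes>\<^bsub>C\<^esub> u \<ominus>\<^bsub>C\<^esub> (v \<otimes>\<^bsub>C\<^esub> v) \<otimes>\<^bsub>C\<^esub> (w \<otimes>\<^bsub>C\<^esub> w)"
      using uC vC wC by algebra
    also have "w \<otimes>\<^bsub>C\<^esub> w = \<ominus>\<^bsub>C\<^esub> \<one>\<^bsub>C\<^esub>" using i by (simp add: w_def)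
    also have "u \<otimes>\<^bsub>C\<^esub> u \<ominus>\<^bsub>C\<^esub> (v \<otimes>\<^bsub>C\<^esub> v) \<otimes>\<^bsub>C\<^esub> (\<ominus>\<^bsub>C\<^esub> \<one>\<^bsub>C\<^esub>) = u \<otimes>\<^bsub>C\<^esub> u \<oplus>\<^bsub>C\<^esub> v \<otimes>\<^bsub>C\<^esub> v"
      using uC vC by algebra
    also have "\<dots> = \<iota> (a \<otimes> a \<oplus> b \<otimes> b \<oplus> \<zero> \<otimes> \<zero>)"
      using ab by (simp add: u_def v_def)
    finally have "\<iota> (a \<otimes> a \<oplus> b \<otimes> b \<oplus> \<zero> \<otimes> \<zero>) = \<zero>\<^bsub>C\<^esub>"
      using uvw by simp
    moreover have "x = \<zero>" if "x \<in> carrier F" "\<iota> x = \<zero>\<^bsub>C\<^esub>" for x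
    proof (rule ccontr)
      assume "x \<noteq> \<zero>"
      then have "\<iota> x \<otimes>\<^bsub>C\<^esub> \<iota> (inv x) = \<one>\<^bsub>C\<^esub>"
        using that(1) \<iota>.hom_mult[of x "inv x"] by simp
      then show False using that \<open>x \<noteq> \<zero>\<close> by simp
    qed
    ultimately have "a \<otimes> a \<oplus> b \<otimes> b \<oplus> \<zero> \<otimes> \<zero> = \<zero>"
      using ab by (meson a_closed m_closed zero_closed)
    then show ?thesis using three_squares_eq_zero[of a b \<zero>] ab by simp
  qed
  show thesis by (rule that[OF C hom h.hom_closed[OF X_closed] i span indep])
qed

text \<open>In coordinates: \<open>(m + n i)\<^sup>2 = s + t i\<close> has a solution because \<open>F(i)\<close> is algebraically closed.\<close>

lemma exists_complex_sqrt:
  assumes "s \<in> carrier F" "t \<in> carrier F"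
  shows "\<exists>m \<in> carrier F. \<exists>n \<in> carrier F. m \<otimes> m \<ominus> n \<otimes> n = s \<and> m \<otimes> n \<oplus> m \<otimes> n = t"
proof (rule adjoin_sqrt_minus_one)
  fix C :: "'a list set ring" and \<iota> i
  assume C: "algebraically_closed C" and hom: "ring_hom_ring F C \<iota>"
    and i: "i \<in> carrier C" "i \<otimes>\<^bsub>C\<^esub> i = \<ominus>\<^bsub>C\<^esub> \<one>\<^bsub>C\<^esub>"
    and span: "\<And>z. z \<in> carrier C \<Longrightarrow>
      \<exists>a \<in> carrier F. \<exists>b \<in> carrier F. z = \<iota> a \<oplus>\<^bsub>C\<^esub> \<iota> b \<otimes>\<^bsub>C\<^esub> i"
    and indep: "\<And>a b. \<lbrakk>a \<in> carrier F; b \<in> carrier F; \<iota> a \<oplus>\<^bsub>C\<^esub> \<iota> b \<otimes>\<^bsub>C\<^esub> i = \<zero>\<^bsub>C\<^esub>\<rbrakk>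
      \<Longrightarrow> a = \<zero> \<and> b = \<zero>"
  interpret C: algebraically_closed C by (rule C)
  interpret \<iota>: ring_hom_ring F C \<iota> by (rule hom)
  define z where "z = \<iota> s \<oplus>\<^bsub>C\<^esub> \<iota> t \<otimes>\<^bsub>C\<^esub> i"
  have z: "z \<in> carrier C" using assms i by (simp add: z_def)
  have "[\<one>\<^bsub>C\<^esub>, \<zero>\<^bsub>C\<^esub>, \<ominus>\<^bsub>C\<^esub> z] \<in> carrier (poly_ring C)"
    using z by (simp add: univ_poly_carrier[symmetric] polynomial_def)
  then obtain w where w: "w \<in> carrier C" "w \<otimes>\<^bsub>C\<^esub> w = z"
    using C.exists_root[of "[\<one>\<^bsub>C\<^esub>, \<zero>\<^bsub>C\<^esub>, \<ominus>\<^bsub>C\<^esub> z]"] z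
    by (auto simp: numeral_2_eq_2 C.r_right_minus_eq[unfolded a_minus_def])
  obtain m n where mn: "m \<in> carrier F" "n \<in> carrier F" "w = \<iota> m \<oplus>\<^bsub>C\<^esub> \<iota> n \<otimes>\<^bsub>C\<^esub> i"
    using span[OF w(1)] by blast
  define a b where "a = m \<otimes> m \<ominus> n \<otimes> n \<ominus> s" and "b = m \<otimes> n \<oplus> m \<otimes> n \<ominus> t"
  have "\<iota> a \<oplus>\<^bsub>C\<^esub> \<iota> b \<otimes>\<^bsub>C\<^esub> i = \<zero>\<^bsub>C\<^esub>"
  proof -
    define u v s' t' where "u = \<iota> m" and "v = \<iota> n" and "s' = \<iota> s" and "t' = \<iota> t"
    have [simp]: "i \<in> carrier C" by (rule i)
    have uC: "u \<in> carrier C" and vC: "v \<in> carrier C" and sC: "s' \<in> carrier C" and tC: "t' \<in> carrier C"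
      using mn assms by (auto simp: u_def v_def s'_def t'_def)
    note [simp] = uC vC sC tC
    have "\<iota> a \<oplus>\<^bsub>C\<^esub> \<iota> b \<otimes>\<^bsub>C\<^esub> i =
      (u \<otimes>\<^bsub>C\<^esub> u \<ominus>\<^bsub>C\<^esub> v \<otimes>\<^bsub>C\<^esub> v \<ominus>\<^bsub>C\<^esub> s') \<oplus>\<^bsub>C\<^esub> (u \<otimes>\<^bsub>C\<^esub> v \<oplus>\<^bsub>C\<^esub> u \<otimes>\<^bsub>C\<^esub> v \<ominus>\<^bsub>C\<^esub> t') \<otimes>\<^bsub>C\<^esub> i"
      using mn assms by (simp add: a_def b_def u_def v_def s'_def t'_def a_minus_def)
    also have "\<dots> = ((u \<oplus>\<^bsub>C\<^esub> v \<otimes>\<^bsub>C\<^esub> i) \<otimes>\<^bsub>C\<^esub> (u \<oplus>\<^bsub>C\<^esub> v \<otimes>\<^bsub>C\<^esub> i) \<ominus>\<^bsub>C\<^esub> (s' \<oplus>\<^bsub>C\<^esub> t' \<otimes>\<^bsub>C\<^esub> i))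
        \<ominus>\<^bsub>C\<^esub> v \<otimes>\<^bsub>C\<^esub> v \<otimes>\<^bsub>C\<^esub> (i \<otimes>\<^bsub>C\<^esub> i \<oplus>\<^bsub>C\<^esub> \<one>\<^bsub>C\<^esub>)"
      using uC vC sC tC i(1) by algebra
    also have "i \<otimes>\<^bsub>C\<^esub> i \<oplus>\<^bsub>C\<^esub> \<one>\<^bsub>C\<^esub> = \<zero>\<^bsub>C\<^esub>" using i by (simp add: C.l_neg)
    finally show ?thesis
      using mn(3) w z by (simp add: u_def[symmetric] v_def[symmetric] s'_def[symmetric] t'_def[symmetric] z_def)
  qed
  then have "a = \<zero>" "b = \<zero>" using indep[of a b] mn assms by (simp_all add: a_def b_def)
  then show ?thesis using mn assms by (intro bexI[of _ m] bexI[of _ n]) (simp_all add: a_def b_def)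
qed

text \<open>Let \<open>s + t i\<close> be a root of \<open>p\<close> in \<open>F(i)\<close>. If \<open>t = 0\<close> then \<open>X - s\<close> is its minimal polynomial over
\<open>F\<close>, otherwise \<open>(X - s)\<^sup>2 + t\<^sup>2\<close> is; the minimal polynomial divides \<open>p\<close>.\<close>

lemma linear_or_quadratic_factor:
  assumes p: "p \<in> carrier P" "degree p > 0"
  shows "(\<exists>s \<in> carrier F. \<exists>q \<in> carrier P. p = lin s \<otimes>\<^bsub>P\<^esub> q) \<or>
    (\<exists>s \<in> carrier F. \<exists>t \<in> carrier F - {\<zero>}. \<exists>q \<in> carrier P. p = quad s t \<otimes>\<^bsub>P\<^esub> q)"
proof (rule adjoin_sqrt_minus_one)
  fix C :: "'a list set ring" and \<iota> i
  assume C: "algebraically_closed C" and hom: "ring_hom_ring F C \<iota>"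
    and i: "i \<in> carrier C" "i \<otimes>\<^bsub>C\<^esub> i = \<ominus>\<^bsub>C\<^esub> \<one>\<^bsub>C\<^esub>"
    and span: "\<And>z. z \<in> carrier C \<Longrightarrow>
      \<exists>a \<in> carrier F. \<exists>b \<in> carrier F. z = \<iota> a \<oplus>\<^bsub>C\<^esub> \<iota> b \<otimes>\<^bsub>C\<^esub> i"
    and indep: "\<And>a b. \<lbrakk>a \<in> carrier F; b \<in> carrier F; \<iota> a \<oplus>\<^bsub>C\<^esub> \<iota> b \<otimes>\<^bsub>C\<^esub> i = \<zero>\<^bsub>C\<^esub>\<rbrakk>
      \<Longrightarrow> a = \<zero> \<and> b = \<zero>"
  interpret C: algebraically_closed C by (rule C)
  interpret \<iota>: ring_hom_ring F C \<iota> by (rule hom)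
  have inj: "x = \<zero>" if "x \<in> carrier F" "\<iota> x = \<zero>\<^bsub>C\<^esub>" for x
    using indep[of x \<zero>] that i by simp
  have "p \<noteq> []" using p(2) by auto
  then have "lead_coeff p \<in> carrier F" "lead_coeff p \<noteq> \<zero>"
    using p(1) poly_carrier_set[OF p(1)] by (auto simp: univ_poly_carrier[symmetric] polynomial_def)
  then have "\<iota> (lead_coeff p) \<noteq> \<zero>\<^bsub>C\<^esub>" using inj by blast
  then have "map \<iota> p \<in> carrier (poly_ring C)"
    using \<open>p \<noteq> []\<close> poly_carrier_set[OF p(1)]
    by (auto simp: univ_poly_carrier[symmetric] polynomial_def hd_map)
  then obtain \<alpha> where \<alpha>: "\<alpha> \<in> carrier C" "C.eval (map \<iota> p) \<alpha> = \<zero>\<^bsub>C\<^esub>"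
    using C.exists_root[of "map \<iota> p"] p(2) by auto
  define ev where "ev = (\<lambda>q. C.eval (map \<iota> q) \<alpha>)"
  interpret ev: ring_hom_ring P C ev
    unfolding ev_def
    by (rule ring_hom_ringI2[OF P.ring_axioms C.ring_axioms \<iota>.eval_map_is_hom[OF C.cring_axioms \<alpha>(1)]])
  have ev_const: "ev (poly_of_const k) = \<iota> k" if "k \<in> carrier F" for k
    using that \<alpha>(1) by (auto simp: ev_def poly_of_const_def)
  have ev_X: "ev X = \<alpha>" using \<alpha>(1) by (simp add: ev_def var_def)
  obtain s t where st: "s \<in> carrier F" "t \<in> carrier F" "\<alpha> = \<iota> s \<oplus>\<^bsub>C\<^esub> \<iota> t \<otimes>\<^bsub>C\<^esub> i"
    using span[OF \<alpha>(1)] by blast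
  have divide: "\<exists>q \<in> carrier P. p = d \<otimes>\<^bsub>P\<^esub> q"
    if d: "d \<in> carrier P" "degree d > 0" "ev d = \<zero>\<^bsub>C\<^esub>"
      and min: "\<And>r. \<lbrakk>r \<in> carrier P; degree r < degree d; ev r = \<zero>\<^bsub>C\<^esub>\<rbrakk> \<Longrightarrow> r = \<zero>\<^bsub>P\<^esub>" for d
  proof -
    obtain q r where qr: "q \<in> carrier P" "r \<in> carrier P" "p = d \<otimes>\<^bsub>P\<^esub> q \<oplus>\<^bsub>P\<^esub> r"
        "r = \<zero>\<^bsub>P\<^esub> \<or> degree r < degree d"
      using subfield_long_division_theorem_shell[OF carrier_is_subfield p(1) d(1) not_zero_if_degree[OF d(2)]]
      by blast
    have "ev p = \<zero>\<^bsub>C\<^esub>" using \<alpha> by (simp add: ev_def)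
    then have "ev r = \<zero>\<^bsub>C\<^esub>" using qr(1-3) d by simp
    then have "r = \<zero>\<^bsub>P\<^esub>" using qr min by blast
    then show ?thesis using qr d by auto
  qed
  show ?thesis
  proof (cases "t = \<zero>")
    case True
    then have \<alpha>_eq: "\<alpha> = \<iota> s" using st i by simp
    have "\<exists>q \<in> carrier P. p = lin s \<otimes>\<^bsub>P\<^esub> q"
    proof (rule divide)
      show "ev (lin s) = \<zero>\<^bsub>C\<^esub>"
        using st(1) \<alpha>_eq by (simp add: ev_const ev_X a_minus_def C.r_neg)
      fix r assume r: "r \<in> carrier P" "degree r < degree (lin s)" "ev r = \<zero>\<^bsub>C\<^esub>"
      then have "r \<in> poly_of_const ` carrier F"
        using degree_lin[OF st(1)] by (simp add: poly_of_const_over_carrier)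
      then obtain k where "k \<in> carrier F" "r = poly_of_const k" by blast
      then show "r = \<zero>\<^bsub>P\<^esub>" using r(3) inj[of k] const.hom_zero by (simp add: ev_const)
    qed (use st degree_lin in simp_all)
    then show ?thesis using st by blast
  next
    case False
    have "\<exists>q \<in> carrier P. p = quad s t \<otimes>\<^bsub>P\<^esub> q"
    proof (rule divide)
      define s' t' where "s' = \<iota> s" and "t' = \<iota> t"
      have [simp]: "i \<in> carrier C" by (rule i)
      have sC: "s' \<in> carrier C" and tC: "t' \<in> carrier C"
        using st by (auto simp: s'_def t'_def)
      note [simp] = sC tC
      have "ev (quad s t) = ((s' \<oplus>\<^bsub>C\<^esub> t' \<otimes>\<^bsub>C\<^esub> i) \<ominus>\<^bsub>C\<^esub> s') \<otimes>\<^bsub>C\<^esub> ((s' \<oplus>\<^bsub>C\<^esub> t' \<otimes>\<^bsub>C\<^esub> i) \<ominus>\<^bsub>C\<^esub> s') \<oplus>\<^bsub>C\<^esub> t' \<otimes>\<^bsub>C\<^esub> t'"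
        using st i by (simp add: ev_const ev_X s'_def t'_def a_minus_def)
      also have "\<dots> = t' \<otimes>\<^bsub>C\<^esub> t' \<otimes>\<^bsub>C\<^esub> (i \<otimes>\<^bsub>C\<^esub> i \<oplus>\<^bsub>C\<^esub> \<one>\<^bsub>C\<^esub>)"
        using sC tC i(1) by algebra
      also have "i \<otimes>\<^bsub>C\<^esub> i \<oplus>\<^bsub>C\<^esub> \<one>\<^bsub>C\<^esub> = \<zero>\<^bsub>C\<^esub>" using i by (simp add: C.l_neg)
      finally show "ev (quad s t) = \<zero>\<^bsub>C\<^esub>" by simp
      fix r assume r: "r \<in> carrier P" "degree r < degree (quad s t)" "ev r = \<zero>\<^bsub>C\<^esub>"
      then have "length r \<le> 2" using degree_quad[OF st(1,2)] by simp
      then obtain a b where ab: "a \<in> carrier F" "b \<in> carrier F"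
        "r = poly_of_const a \<oplus>\<^bsub>P\<^esub> poly_of_const b \<otimes>\<^bsub>P\<^esub> X"
        using length_le_2_linear r(1) by blast
      have "ev r = \<iota> a \<oplus>\<^bsub>C\<^esub> \<iota> b \<otimes>\<^bsub>C\<^esub> \<alpha>"
        unfolding ab(3) using ab(1,2) by (simp add: ev_const ev_X)
      also have "\<dots> = \<iota> (a \<oplus> b \<otimes> s) \<oplus>\<^bsub>C\<^esub> \<iota> (b \<otimes> t) \<otimes>\<^bsub>C\<^esub> i"
        unfolding st(3) using ab(1,2) st(1,2) by (simp add: C.r_distr C.m_assoc C.a_assoc)
      finally have "a \<oplus> b \<otimes> s = \<zero> \<and> b \<otimes> t = \<zero>"
        using r(3) indep[of "a \<oplus> b \<otimes> s" "b \<otimes> t"] ab(1,2) st(1,2) by simp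
      then have "b = \<zero> \<and> a = \<zero>"
        using ab st False integral[of b t] by auto
      then show "r = \<zero>\<^bsub>P\<^esub>" using ab by simp
    qed (use st degree_quad in simp_all)
    then show ?thesis using st False by blast
  qed
qed

end

section \<open>Identities in a commutative ring\<close>

context cring
begin

text \<open>Here, and in the next lemma, the relation of the conic enters by adding a multiple of
\<open>y\<^sup>2 + (x\<^sup>2 + 1) = 0\<close>; the intermediate equation displays the multiplier.\<close>

lemma conic_norm:
  assumes "x \<in> carrier R" "y \<in> carrier R" "a \<in> carrier R" "b \<in> carrier R"
    and "y \<otimes> y \<oplus> (x \<otimes> x \<oplus> \<one>) = \<zero>"
  shows "(a \<oplus> b \<otimes> y) \<otimes> (a \<ominus> b \<otimes> y) = a \<otimes> a \<oplus> b \<otimes> b \<oplus> (x \<otimes> b) \<otimes> (x \<otimes> b)"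
proof -
  have "(a \<oplus> b \<otimes> y) \<otimes> (a \<ominus> b \<otimes> y) = (a \<otimes> a \<oplus> b \<otimes> b \<oplus> (x \<otimes> b) \<otimes> (x \<otimes> b))
      \<ominus> b \<otimes> b \<otimes> (y \<otimes> y \<oplus> (x \<otimes> x \<oplus> \<one>))"
    using assms(1-4) by algebra
  then show ?thesis using assms by simp
qed

lemma conic_mult:
  assumes "x \<in> carrier R" "y \<in> carrier R" "a \<in> carrier R" "b \<in> carrier R" "c \<in> carrier R" "d \<in> carrier R"
    and "y \<otimes> y \<oplus> (x \<otimes> x \<oplus> \<one>) = \<zero>"
  shows "(a \<oplus> b \<otimes> y) \<otimes> (c \<oplus> d \<otimes> y) =
    (a \<otimes> c \<ominus> b \<otimes> d \<otimes> (\<one> \<oplus> x \<otimes> x)) \<oplus> (a \<otimes> d \<oplus> b \<otimes> c) \<otimes> y"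
proof -
  have "(a \<oplus> b \<otimes> y) \<otimes> (c \<oplus> d \<otimes> y) =
      (a \<otimes> c \<ominus> b \<otimes> d \<otimes> (\<one> \<oplus> x \<otimes> x)) \<oplus> (a \<otimes> d \<oplus> b \<otimes> c) \<otimes> y
      \<oplus> b \<otimes> d \<otimes> (y \<otimes> y \<oplus> (x \<otimes> x \<oplus> \<one>))"
    using assms(1-6) by algebra
  then show ?thesis using assms by simp
qed

text \<open>This is \<open>a\<^sup>2 + (1 + x\<^sup>2) b\<^sup>2\<close>, the norm of \<open>a + b \<surd>(-1-x\<^sup>2)\<close>, written as a sum of three squares so that formal
reality applies to it.\<close>

definition conic_norm_form :: "'a \<Rightarrow> 'a \<Rightarrow> 'a \<Rightarrow> 'a"
  where "conic_norm_form x a b = a \<otimes> a \<oplus> b \<otimes> b \<oplus> (x \<otimes> b) \<otimes> (x \<otimes> b)"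

lemma conic_norm_form_closed [simp]:
  "\<lbrakk>x \<in> carrier R; a \<in> carrier R; b \<in> carrier R\<rbrakk> \<Longrightarrow> conic_norm_form x a b \<in> carrier R"
  by (simp add: conic_norm_form_def)

text \<open>Multiplicativity of the norm of \<open>a + b \<surd>(-1-x\<^sup>2)\<close>, in the manner of Brahmagupta's identity.\<close>

lemma conic_norm_form_mult:
  assumes "x \<in> carrier R" "a \<in> carrier R" "b \<in> carrier R" "c \<in> carrier R" "d \<in> carrier R"
  shows "conic_norm_form x (a \<otimes> c \<ominus> b \<otimes> d \<otimes> (\<one> \<oplus> x \<otimes> x)) (a \<otimes> d \<oplus> b \<otimes> c) =
    conic_norm_form x a b \<otimes> conic_norm_form x c d"
proof -
  define e where "e = \<one> \<oplus> x \<otimes> x"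
  have e: "e \<in> carrier R" using assms(1) by (simp add: e_def)
  have alt: "conic_norm_form x p q = p \<otimes> p \<oplus> e \<otimes> (q \<otimes> q)" if "p \<in> carrier R" "q \<in> carrier R" for p q
    unfolding conic_norm_form_def e_def using that assms(1) by algebra
  have "(a \<otimes> c \<ominus> b \<otimes> d \<otimes> e) \<otimes> (a \<otimes> c \<ominus> b \<otimes> d \<otimes> e) \<oplus> e \<otimes> ((a \<otimes> d \<oplus> b \<otimes> c) \<otimes> (a \<otimes> d \<oplus> b \<otimes> c)) =
      (a \<otimes> a \<oplus> e \<otimes> (b \<otimes> b)) \<otimes> (c \<otimes> c \<oplus> e \<otimes> (d \<otimes> d))"
    using assms(2-5) e by algebra
  then show ?thesis
    using assms e by (simp add: alt e_def[symmetric])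
qed

text \<open>Modulo \<open>l\<close> one has \<open>j\<^sup>2 = -e\<close>, so \<open>c + d j\<close> has the norm \<open>c\<^sup>2 + d\<^sup>2 e\<close>, and its inverse is the conjugate
\<open>c - d j\<close> divided by the norm. The second summand records the multiple of \<open>l\<close> involved.\<close>

lemma norm_form_inverse:
  assumes "c \<in> carrier R" "d \<in> carrier R" "e \<in> carrier R" "w \<in> carrier R"
    "j \<in> carrier R" "l \<in> carrier R" "r \<in> carrier R" "s \<in> carrier R"
    and "j \<otimes> j \<oplus> e = l \<otimes> s" "(c \<otimes> c \<oplus> d \<otimes> d \<otimes> e) \<otimes> w = \<one>"
  shows "(c \<oplus> d \<otimes> j \<oplus> l \<otimes> r) \<otimes> ((c \<ominus> d \<otimes> j) \<otimes> w) \<oplus>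
    l \<otimes> ((d \<otimes> d \<otimes> s \<ominus> r \<otimes> (c \<ominus> d \<otimes> j)) \<otimes> w) = \<one>"
proof -
  have "(c \<oplus> d \<otimes> j \<oplus> l \<otimes> r) \<otimes> ((c \<ominus> d \<otimes> j) \<otimes> w) \<oplus>
      l \<otimes> ((d \<otimes> d \<otimes> s \<ominus> r \<otimes> (c \<ominus> d \<otimes> j)) \<otimes> w) =
      ((c \<oplus> d \<otimes> j) \<otimes> (c \<ominus> d \<otimes> j)) \<otimes> w \<oplus> (d \<otimes> d) \<otimes> (l \<otimes> s) \<otimes> w"
  proof -
    define p q D where "p = c \<oplus> d \<otimes> j" and "q = c \<ominus> d \<otimes> j" and "D = d \<otimes> d"
    have "p \<in> carrier R" "q \<in> carrier R" "D \<in> carrier R"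
      using assms(1,2,5) by (simp_all add: p_def q_def D_def)
    then have "(p \<oplus> l \<otimes> r) \<otimes> (q \<otimes> w) \<oplus> l \<otimes> ((D \<otimes> s \<ominus> r \<otimes> q) \<otimes> w) = (p \<otimes> q) \<otimes> w \<oplus> D \<otimes> (l \<otimes> s) \<otimes> w"
      using assms(4,6,7,8) by algebra
    then show ?thesis unfolding p_def q_def D_def .
  qed
  also have "(c \<oplus> d \<otimes> j) \<otimes> (c \<ominus> d \<otimes> j) = c \<otimes> c \<ominus> (d \<otimes> d) \<otimes> (j \<otimes> j)"
    using assms(1,2,5) by algebra
  also have "(c \<otimes> c \<ominus> (d \<otimes> d) \<otimes> (j \<otimes> j)) \<otimes> w \<oplus> (d \<otimes> d) \<otimes> (l \<otimes> s) \<otimes> w = (c \<otimes> c \<oplus> d \<otimes> d \<otimes> e) \<otimes> w"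
  proof -
    define C D J where "C = c \<otimes> c" and "D = d \<otimes> d" and "J = j \<otimes> j"
    have "C \<in> carrier R" "D \<in> carrier R" "J \<in> carrier R"
      using assms(1,2,5) by (simp_all add: C_def D_def J_def)
    then have "(C \<ominus> D \<otimes> J) \<otimes> w \<oplus> D \<otimes> (J \<oplus> e) \<otimes> w = (C \<oplus> D \<otimes> e) \<otimes> w"
      using assms(3,4) by algebra
    then show ?thesis unfolding C_def D_def J_def assms(9) .
  qed
  also have "\<dots> = \<one>" by (rule assms(10))
  finally show ?thesis .
qed

text \<open>With \<open>x = s + t j\<close>, the product is \<open>y\<^sup>2 - (m + n j)\<^sup>2 = -(1 + (s + t j)\<^sup>2 + (m + n j)\<^sup>2)\<close>. The hypotheses on \<open>m\<close>
and \<open>n\<close> are the real and the imaginary part of \<open>(m + n i)\<^sup>2 = -1 - (s + t i)\<^sup>2\<close>; they turn this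
polynomial in \<open>j\<close> into a multiple of \<open>j\<^sup>2 + 1\<close>.\<close>

lemma line_pair_product:
  assumes "y \<in> carrier R" "s \<in> carrier R" "t \<in> carrier R" "m \<in> carrier R" "n \<in> carrier R" "j \<in> carrier R"
    and y: "y \<otimes> y \<oplus> ((s \<oplus> t \<otimes> j) \<otimes> (s \<oplus> t \<otimes> j) \<oplus> \<one>) = \<zero>"
    and re: "s \<otimes> s \<oplus> \<one> \<oplus> m \<otimes> m = t \<otimes> t \<oplus> n \<otimes> n"
    and im: "m \<otimes> n \<oplus> m \<otimes> n \<oplus> (s \<otimes> t \<oplus> s \<otimes> t) = \<zero>"
  shows "(y \<oplus> (m \<oplus> n \<otimes> j)) \<otimes> (y \<ominus> (m \<oplus> n \<otimes> j)) = \<ominus> ((t \<otimes> t \<oplus> n \<otimes> n) \<otimes> (j \<otimes> j \<oplus> \<one>))"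
proof -
  define x b where "x = s \<oplus> t \<otimes> j" and "b = m \<oplus> n \<otimes> j"
  have xb: "x \<in> carrier R" "b \<in> carrier R" using assms(2-6) by (simp_all add: x_def b_def)
  have "(x \<otimes> x \<oplus> \<one>) \<oplus> b \<otimes> b =
      (s \<otimes> s \<oplus> \<one> \<oplus> m \<otimes> m) \<oplus> (m \<otimes> n \<oplus> m \<otimes> n \<oplus> (s \<otimes> t \<oplus> s \<otimes> t)) \<otimes> j \<oplus> (t \<otimes> t \<oplus> n \<otimes> n) \<otimes> (j \<otimes> j)"
    unfolding x_def b_def using assms(2-6) by algebra
  also have "\<dots> = (t \<otimes> t \<oplus> n \<otimes> n) \<otimes> (j \<otimes> j \<oplus> \<one>)"
    unfolding re im using assms(2-6) by algebra
  finally have norm: "(x \<otimes> x \<oplus> \<one>) \<oplus> b \<otimes> b = (t \<otimes> t \<oplus> n \<otimes> n) \<otimes> (j \<otimes> j \<oplus> \<one>)" .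
  have "(y \<oplus> b) \<otimes> (y \<ominus> b) = (y \<otimes> y \<oplus> (x \<otimes> x \<oplus> \<one>)) \<ominus> ((x \<otimes> x \<oplus> \<one>) \<oplus> b \<otimes> b)"
    using assms(1) xb by algebra
  also have "y \<otimes> y \<oplus> (x \<otimes> x \<oplus> \<one>) = \<zero>" unfolding x_def by (rule y)
  also have "\<zero> \<ominus> ((x \<otimes> x \<oplus> \<one>) \<oplus> b \<otimes> b) = \<ominus> ((x \<otimes> x \<oplus> \<one>) \<oplus> b \<otimes> b)"
    using xb by (simp add: a_minus_def)
  finally show ?thesis unfolding norm unfolding b_def .
qed

text \<open>Replacing \<open>y\<close> by \<open>-(m + n j)\<close> and \<open>j\<^sup>2\<close> by \<open>-1\<close> is allowed modulo \<open>l\<close>; the last summand collects the multiples of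
\<open>l\<close> that this costs.\<close>

lemma reduce_modulo_line:
  assumes "c \<in> carrier R" "d \<in> carrier R" "r \<in> carrier R" "c' \<in> carrier R" "d' \<in> carrier R" "r' \<in> carrier R"
    "m \<in> carrier R" "n \<in> carrier R" "j \<in> carrier R" "l \<in> carrier R" "k \<in> carrier R" "y \<in> carrier R"
    and j: "j \<otimes> j \<oplus> \<one> = l \<otimes> k" and l: "l = y \<oplus> (m \<oplus> n \<otimes> j)"
  shows "(c \<oplus> d \<otimes> j \<oplus> l \<otimes> r) \<oplus> (c' \<oplus> d' \<otimes> j \<oplus> l \<otimes> r') \<otimes> y =
    (c \<ominus> c' \<otimes> m \<oplus> d' \<otimes> n) \<oplus> (d \<ominus> c' \<otimes> n \<ominus> d' \<otimes> m) \<otimes> j \<oplus>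
    l \<otimes> (r \<oplus> r' \<otimes> y \<oplus> c' \<oplus> d' \<otimes> j \<ominus> d' \<otimes> n \<otimes> k)"
proof -
  define u v b where "u = c \<oplus> d \<otimes> j" and "v = c' \<oplus> d' \<otimes> j" and "b = m \<oplus> n \<otimes> j"
  have uvb: "u \<in> carrier R" "v \<in> carrier R" "b \<in> carrier R"
    using assms(1-9) by (simp_all add: u_def v_def b_def)
  have "(u \<oplus> l \<otimes> r) \<oplus> (v \<oplus> l \<otimes> r') \<otimes> y = (u \<oplus> v \<otimes> y) \<oplus> l \<otimes> (r \<oplus> r' \<otimes> y)"
    using uvb(1,2) assms(3,6,10,12) by algebra
  also have "u \<oplus> v \<otimes> y = (u \<ominus> v \<otimes> b) \<oplus> v \<otimes> l"
    unfolding l b_def[symmetric] using uvb assms(12) by algebra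
  also have "u \<ominus> v \<otimes> b = (c \<ominus> c' \<otimes> m \<oplus> d' \<otimes> n) \<oplus> (d \<ominus> c' \<otimes> n \<ominus> d' \<otimes> m) \<otimes> j
      \<ominus> (d' \<otimes> n) \<otimes> (j \<otimes> j \<oplus> \<one>)"
    unfolding u_def v_def b_def using assms(1,2,4,5,7-9) by algebra
  also have "j \<otimes> j \<oplus> \<one> = l \<otimes> k" by (rule j)
  finally have eq: "(u \<oplus> l \<otimes> r) \<oplus> (v \<oplus> l \<otimes> r') \<otimes> y =
      (c \<ominus> c' \<otimes> m \<oplus> d' \<otimes> n) \<oplus> (d \<ominus> c' \<otimes> n \<ominus> d' \<otimes> m) \<otimes> j
      \<ominus> (d' \<otimes> n) \<otimes> (l \<otimes> k) \<oplus> v \<otimes> l \<oplus> l \<otimes> (r \<oplus> r' \<otimes> y)" .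
  define p q where "p = c \<ominus> c' \<otimes> m \<oplus> d' \<otimes> n" and "q = d \<ominus> c' \<otimes> n \<ominus> d' \<otimes> m"
  have pq: "p \<in> carrier R" "q \<in> carrier R" using assms(1-8) by (simp_all add: p_def q_def)
  have "p \<oplus> q \<otimes> j \<ominus> (d' \<otimes> n) \<otimes> (l \<otimes> k) \<oplus> v \<otimes> l \<oplus> l \<otimes> (r \<oplus> r' \<otimes> y) =
      p \<oplus> q \<otimes> j \<oplus> l \<otimes> (r \<oplus> r' \<otimes> y \<oplus> v \<ominus> d' \<otimes> n \<otimes> k)"
    using pq uvb(2) assms(3,5,6,8-12) by algebra
  moreover have "r \<oplus> r' \<otimes> y \<oplus> v = r \<oplus> r' \<otimes> y \<oplus> c' \<oplus> d' \<otimes> j"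
    unfolding v_def using assms(3-6,9,12) by (simp add: a_assoc)
  ultimately show ?thesis using eq unfolding u_def v_def p_def q_def by simp
qed

end

section \<open>The norm form of the conic\<close>

text \<open>The coordinate ring as a free \<open>F[X]\<close>-module with basis \<open>1, y\<close> and a prescribed value of \<open>y\<^sup>2\<close>. This
separates its arithmetic from its construction as a ring of cosets.\<close>

locale conic_presentation = real_closed_field F + R: cring R + \<pi>: ring_hom_ring "poly_ring F" R \<pi>
  for F (structure) and R (structure) and \<pi> +
  fixes y
  assumes y_closed [simp]: "y \<in> carrier R"
    and conic_eq: "y \<otimes>\<^bsub>R\<^esub> y \<oplus>\<^bsub>R\<^esub> (\<pi> X \<otimes>\<^bsub>R\<^esub> \<pi> X \<oplus>\<^bsub>R\<^esub> \<one>\<^bsub>R\<^esub>) = \<zero>\<^bsub>R\<^esub>"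
    and span: "f \<in> carrier R \<Longrightarrow> \<exists>a \<in> carrier (poly_ring F). \<exists>b \<in> carrier (poly_ring F).
      f = \<pi> a \<oplus>\<^bsub>R\<^esub> \<pi> b \<otimes>\<^bsub>R\<^esub> y"
    and indep: "\<lbrakk>a \<in> carrier (poly_ring F); b \<in> carrier (poly_ring F);
      \<pi> a \<oplus>\<^bsub>R\<^esub> \<pi> b \<otimes>\<^bsub>R\<^esub> y = \<zero>\<^bsub>R\<^esub>\<rbrakk> \<Longrightarrow> a = \<zero>\<^bsub>poly_ring F\<^esub> \<and> b = \<zero>\<^bsub>poly_ring F\<^esub>"
begin

abbreviation norm_form where "norm_form \<equiv> P.conic_norm_form X"

lemma \<pi>_eq_zeroD: 
  assumes "a \<in> carrier P" "\<pi> a = \<zero>\<^bsub>R\<^esub>"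
  shows "a = \<zero>\<^bsub>P\<^esub>"
  using indep[OF assms(1) P.zero_closed] assms by simp

lemma \<pi>_norm_form:
  assumes "a \<in> carrier P" "b \<in> carrier P"
  shows "\<pi> (norm_form a b) = (\<pi> a \<oplus>\<^bsub>R\<^esub> \<pi> b \<otimes>\<^bsub>R\<^esub> y) \<otimes>\<^bsub>R\<^esub> (\<pi> a \<ominus>\<^bsub>R\<^esub> \<pi> b \<otimes>\<^bsub>R\<^esub> y)"
  using R.conic_norm[OF _ _ _ _ conic_eq, of "\<pi> a" "\<pi> b"] assms
  by (simp add: P.conic_norm_form_def)

lemma norm_form_eq_zeroD:
  assumes "a \<in> carrier P" "b \<in> carrier P" "norm_form a b = \<zero>\<^bsub>P\<^esub>"
  shows "a = \<zero>\<^bsub>P\<^esub> \<and> b = \<zero>\<^bsub>P\<^esub>"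
  using three_poly_squares_eq_zero[of a b "X \<otimes>\<^bsub>P\<^esub> b"] assms
  by (simp add: P.conic_norm_form_def)

text \<open>The summand \<open>(X b)\<^sup>2\<close> is what forces \<open>b\<close> to vanish: a nonzero \<open>b\<close> would make \<open>X b\<close> nonconstant.\<close>

lemma norm_form_degree_eq_zeroD:
  assumes "a \<in> carrier P" "b \<in> carrier P" "degree (norm_form a b) = 0"
  shows "degree a = 0 \<and> b = \<zero>\<^bsub>P\<^esub>"
proof -
  have "degree a = 0" "degree (X \<otimes>\<^bsub>P\<^esub> b) = 0"
    using three_poly_squares_const[of a b "X \<otimes>\<^bsub>P\<^esub> b"] assms
    by (simp_all add: P.conic_norm_form_def)
  moreover have "X \<noteq> \<zero>\<^bsub>P\<^esub>" using degree_X by (intro not_zero_if_degree) simp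
  ultimately show ?thesis
    using degree_mult[OF X_closed assms(2)] degree_X by fastforce
qed

text \<open>Coordinates of two factors and of their product at once, with the norms related: this is how questions
about products in the coordinate ring are moved to \<open>F[X]\<close>.\<close>

lemma mult_norm_form:
  assumes "f \<in> carrier R" "g \<in> carrier R"
  obtains a b c d u v where "a \<in> carrier P" "b \<in> carrier P" "c \<in> carrier P" "d \<in> carrier P"
    "u \<in> carrier P" "v \<in> carrier P"
    "f = \<pi> a \<oplus>\<^bsub>R\<^esub> \<pi> b \<otimes>\<^bsub>R\<^esub> y" "g = \<pi> c \<oplus>\<^bsub>R\<^esub> \<pi> d \<otimes>\<^bsub>R\<^esub> y"
    "f \<otimes>\<^bsub>R\<^esub> g = \<pi> u \<oplus>\<^bsub>R\<^esub> \<pi> v \<otimes>\<^bsub>R\<^esub> y"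
    "norm_form u v = norm_form a b \<otimes>\<^bsub>P\<^esub> norm_form c d"
proof -
  obtain a b where ab: "a \<in> carrier P" "b \<in> carrier P" "f = \<pi> a \<oplus>\<^bsub>R\<^esub> \<pi> b \<otimes>\<^bsub>R\<^esub> y"
    using span assms(1) by blast
  obtain c d where cd: "c \<in> carrier P" "d \<in> carrier P" "g = \<pi> c \<oplus>\<^bsub>R\<^esub> \<pi> d \<otimes>\<^bsub>R\<^esub> y"
    using span assms(2) by blast
  define u where "u = a \<otimes>\<^bsub>P\<^esub> c \<ominus>\<^bsub>P\<^esub> b \<otimes>\<^bsub>P\<^esub> d \<otimes>\<^bsub>P\<^esub> (\<one>\<^bsub>P\<^esub> \<oplus>\<^bsub>P\<^esub> X \<otimes>\<^bsub>P\<^esub> X)"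
  define v where "v = a \<otimes>\<^bsub>P\<^esub> d \<oplus>\<^bsub>P\<^esub> b \<otimes>\<^bsub>P\<^esub> c"
  have fg: "f \<otimes>\<^bsub>R\<^esub> g = \<pi> u \<oplus>\<^bsub>R\<^esub> \<pi> v \<otimes>\<^bsub>R\<^esub> y"
    using R.conic_mult[OF _ _ _ _ _ _ conic_eq, of "\<pi> a" "\<pi> b" "\<pi> c" "\<pi> d"] ab cd
    by (simp add: u_def v_def a_minus_def)
  have uv: "norm_form u v = norm_form a b \<otimes>\<^bsub>P\<^esub> norm_form c d"
    unfolding u_def v_def by (rule P.conic_norm_form_mult[OF X_closed ab(1,2) cd(1,2)])
  have "u \<in> carrier P" "v \<in> carrier P" using ab cd by (simp_all add: u_def v_def)
  then show thesis by (rule that[OF ab(1,2) cd(1,2) _ _ ab(3) cd(3) fg uv])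
qed

lemma representation_unique:
  assumes "a \<in> carrier P" "b \<in> carrier P" "c \<in> carrier P" "d \<in> carrier P"
    and eq: "\<pi> a \<oplus>\<^bsub>R\<^esub> \<pi> b \<otimes>\<^bsub>R\<^esub> y = \<pi> c \<oplus>\<^bsub>R\<^esub> \<pi> d \<otimes>\<^bsub>R\<^esub> y"
  shows "a = c \<and> b = d"
proof -
  define a' b' c' d' where "a' = \<pi> a" "b' = \<pi> b" "c' = \<pi> c" "d' = \<pi> d"
  have aR: "a' \<in> carrier R" and bR: "b' \<in> carrier R" and cR: "c' \<in> carrier R" and dR: "d' \<in> carrier R"
    and yR: "y \<in> carrier R"
    using assms(1-4) by (simp_all add: a'_b'_c'_d'_def)
  have "(a' \<ominus>\<^bsub>R\<^esub> c') \<oplus>\<^bsub>R\<^esub> (b' \<ominus>\<^bsub>R\<^esub> d') \<otimes>\<^bsub>R\<^esub> y = (a' \<oplus>\<^bsub>R\<^esub> b' \<otimes>\<^bsub>R\<^esub> y) \<ominus>\<^bsub>R\<^esub> (c' \<oplus>\<^bsub>R\<^esub> d' \<otimes>\<^bsub>R\<^esub> y)"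
    using aR bR cR dR yR by algebra
  also have "\<dots> = \<zero>\<^bsub>R\<^esub>" using eq cR dR by (simp add: a'_b'_c'_d'_def)
  finally have "\<pi> (a \<ominus>\<^bsub>P\<^esub> c) \<oplus>\<^bsub>R\<^esub> \<pi> (b \<ominus>\<^bsub>P\<^esub> d) \<otimes>\<^bsub>R\<^esub> y = \<zero>\<^bsub>R\<^esub>"
    using assms(1-4) by (simp add: a'_b'_c'_d'_def a_minus_def)
  then have "a \<ominus>\<^bsub>P\<^esub> c = \<zero>\<^bsub>P\<^esub> \<and> b \<ominus>\<^bsub>P\<^esub> d = \<zero>\<^bsub>P\<^esub>"
    by (rule indep[OF P.minus_closed[OF assms(1,3)] P.minus_closed[OF assms(2,4)]])
  then show ?thesis
    using P.eq_if_diff_eq_zero[OF assms(1,3)] P.eq_if_diff_eq_zero[OF assms(2,4)] by blast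
qed

sublocale R: domain R
proof (unfold_locales)
  have "\<pi> \<one>\<^bsub>P\<^esub> \<noteq> \<zero>\<^bsub>R\<^esub>" using \<pi>_eq_zeroD[OF P.one_closed] by auto
  then show "\<one>\<^bsub>R\<^esub> \<noteq> \<zero>\<^bsub>R\<^esub>" by simp
next
  fix f g assume fg: "f \<otimes>\<^bsub>R\<^esub> g = \<zero>\<^bsub>R\<^esub>" "f \<in> carrier R" "g \<in> carrier R"
  obtain a b c d u v where abcd: "a \<in> carrier P" "b \<in> carrier P" "c \<in> carrier P" "d \<in> carrier P"
    and uv: "u \<in> carrier P" "v \<in> carrier P"
    and f: "f = \<pi> a \<oplus>\<^bsub>R\<^esub> \<pi> b \<otimes>\<^bsub>R\<^esub> y" and g: "g = \<pi> c \<oplus>\<^bsub>R\<^esub> \<pi> d \<otimes>\<^bsub>R\<^esub> y"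
    and m: "f \<otimes>\<^bsub>R\<^esub> g = \<pi> u \<oplus>\<^bsub>R\<^esub> \<pi> v \<otimes>\<^bsub>R\<^esub> y" "norm_form u v = norm_form a b \<otimes>\<^bsub>P\<^esub> norm_form c d"
    by (rule mult_norm_form[OF fg(2,3)])
  have "u = \<zero>\<^bsub>P\<^esub> \<and> v = \<zero>\<^bsub>P\<^esub>" using indep[OF uv m(1)[symmetric, unfolded fg(1)]] .
  then have "norm_form a b \<otimes>\<^bsub>P\<^esub> norm_form c d = \<zero>\<^bsub>P\<^esub>"
    using m(2) by (simp add: P.conic_norm_form_def)
  then have "norm_form a b = \<zero>\<^bsub>P\<^esub> \<or> norm_form c d = \<zero>\<^bsub>P\<^esub>"
    using abcd by (simp add: P.integral_iff)
  then show "f = \<zero>\<^bsub>R\<^esub> \<or> g = \<zero>\<^bsub>R\<^esub>"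
  proof
    assume "norm_form a b = \<zero>\<^bsub>P\<^esub>"
    then have "a = \<zero>\<^bsub>P\<^esub> \<and> b = \<zero>\<^bsub>P\<^esub>" by (rule norm_form_eq_zeroD[OF abcd(1,2)])
    then have "f = \<zero>\<^bsub>R\<^esub>" unfolding f by simp
    then show ?thesis ..
  next
    assume "norm_form c d = \<zero>\<^bsub>P\<^esub>"
    then have "c = \<zero>\<^bsub>P\<^esub> \<and> d = \<zero>\<^bsub>P\<^esub>" by (rule norm_form_eq_zeroD[OF abcd(3,4)])
    then have "g = \<zero>\<^bsub>R\<^esub>" unfolding g by simp
    then show ?thesis ..
  qed
qed

text \<open>The embedding of \<open>F\<close> as the field of constants.\<close>

definition \<kappa> where "\<kappa> c = \<pi> (poly_of_const c)"

sublocale \<kappa>: ring_hom_ring F R \<kappa>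
proof (rule ring_hom_ringI2[OF ring_axioms R.ring_axioms])
  have "\<kappa> = \<pi> \<circ> poly_of_const" by (auto simp: \<kappa>_def)
  then show "\<kappa> \<in> ring_hom F R" using ring_hom_trans[OF const.homh \<pi>.homh] by simp
qed

lemma \<kappa>_inv:
  assumes "c \<in> carrier F" "c \<noteq> \<zero>"
  shows "\<kappa> c \<otimes>\<^bsub>R\<^esub> \<kappa> (inv c) = \<one>\<^bsub>R\<^esub>"
  using \<kappa>.hom_mult[of c "inv c"] assms by simp

text \<open>The norm of a unit is a unit of \<open>F[X]\<close>, that is, a nonzero constant.\<close>

lemma unit_is_const:
  assumes "f \<in> Units R"
  obtains c where "c \<in> carrier F" "f = \<kappa> c"
proof -
  obtain g where fg: "f \<in> carrier R" "g \<in> carrier R" "f \<otimes>\<^bsub>R\<^esub> g = \<one>\<^bsub>R\<^esub>"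
    using assms unfolding Units_def by blast
  obtain a b c d u v where abcd: "a \<in> carrier P" "b \<in> carrier P" "c \<in> carrier P" "d \<in> carrier P"
    and uv: "u \<in> carrier P" "v \<in> carrier P"
    and f: "f = \<pi> a \<oplus>\<^bsub>R\<^esub> \<pi> b \<otimes>\<^bsub>R\<^esub> y" and g: "g = \<pi> c \<oplus>\<^bsub>R\<^esub> \<pi> d \<otimes>\<^bsub>R\<^esub> y"
    and m: "f \<otimes>\<^bsub>R\<^esub> g = \<pi> u \<oplus>\<^bsub>R\<^esub> \<pi> v \<otimes>\<^bsub>R\<^esub> y" "norm_form u v = norm_form a b \<otimes>\<^bsub>P\<^esub> norm_form c d"
    by (rule mult_norm_form[OF fg(1,2)])
  have "u = \<one>\<^bsub>P\<^esub> \<and> v = \<zero>\<^bsub>P\<^esub>"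
    using representation_unique[of u v "\<one>\<^bsub>P\<^esub>" "\<zero>\<^bsub>P\<^esub>"] uv m(1) fg(3) by simp
  then have n: "norm_form a b \<otimes>\<^bsub>P\<^esub> norm_form c d = \<one>\<^bsub>P\<^esub>"
    using m(2) by (simp add: P.conic_norm_form_def)
  then have "norm_form a b \<in> Units P"
    using abcd by (auto simp: Units_def intro!: bexI[of _ "norm_form c d"] simp: P.m_comm)
  then have "degree (norm_form a b) = 0"
    by (simp add: univ_poly_units'[OF carrier_is_subfield])
  then have ab: "degree a = 0" "b = \<zero>\<^bsub>P\<^esub>" using norm_form_degree_eq_zeroD abcd by blast+
  then have "a \<in> poly_of_const ` carrier F" using abcd(1) by (simp add: poly_of_const_over_carrier)
  then obtain k where "k \<in> carrier F" "a = poly_of_const k" by blast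
  moreover from this have "f = \<kappa> k" using f ab abcd by (simp add: \<kappa>_def)
  ultimately show thesis using that by blast
qed

section \<open>The coordinate ring is not Euclidean\<close>

lemma \<pi>_X_not_unit: "\<pi> X \<notin> Units R"
proof
  assume "\<pi> X \<in> Units R"
  then obtain c where c: "c \<in> carrier F" "\<pi> X = \<kappa> c" by (rule unit_is_const)
  have "X = poly_of_const c"
    using representation_unique[of X "\<zero>\<^bsub>P\<^esub>" "poly_of_const c" "\<zero>\<^bsub>P\<^esub>"] c by (simp add: \<kappa>_def)
  then show False using degree_X degree_const[of c] by simp
qed

text \<open>For a nonzero nonunit \<open>b\<close> of least Euclidean value, all remainders modulo \<open>b\<close> are constants. Reducing \<open>x\<close>
and \<open>y\<close> to constants \<open>c\<close> and \<open>d\<close> gives an \<open>F\<close>-rational point of the conic modulo \<open>b\<close>; there is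
none, because \<open>c\<^sup>2 + d\<^sup>2 + 1\<close> is a unit.\<close>

lemma not_euclidean: "\<not> euclidean_domain R \<phi>"
proof
  assume "euclidean_domain R \<phi>"
  then interpret E: euclidean_domain R \<phi> .
  define N where "N = {f \<in> carrier R. f \<noteq> \<zero>\<^bsub>R\<^esub> \<and> f \<notin> Units R}"
  have "X \<noteq> \<zero>\<^bsub>P\<^esub>" using degree_X by (intro not_zero_if_degree) simp
  then have "\<pi> X \<in> N" using \<pi>_X_not_unit \<pi>_eq_zeroD by (auto simp: N_def)
  then obtain b where b: "b \<in> N" and min: "\<And>r. r \<in> N \<Longrightarrow> \<phi> b \<le> \<phi> r"
    using ex_has_least_nat[of "\<lambda>r. r \<in> N" _ \<phi>] by blast
  have bR: "b \<in> carrier R" "b \<noteq> \<zero>\<^bsub>R\<^esub>" "b \<notin> Units R" using b by (auto simp: N_def)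
  have const: "\<exists>q \<in> carrier R. \<exists>c \<in> carrier F. f = b \<otimes>\<^bsub>R\<^esub> q \<oplus>\<^bsub>R\<^esub> \<kappa> c" if f: "f \<in> carrier R" for f
  proof (cases "f = \<zero>\<^bsub>R\<^esub>")
    case True
    then have "f = b \<otimes>\<^bsub>R\<^esub> \<zero>\<^bsub>R\<^esub> \<oplus>\<^bsub>R\<^esub> \<kappa> \<zero>" using bR by simp
    then show ?thesis by blast
  next
    case False
    then obtain q r where qr: "q \<in> carrier R" "r \<in> carrier R" "f = b \<otimes>\<^bsub>R\<^esub> q \<oplus>\<^bsub>R\<^esub> r"
        "r = \<zero>\<^bsub>R\<^esub> \<or> \<phi> r < \<phi> b"
      using E.euclidean_function[of f b] f bR by blast
    have "r \<notin> N"
    proof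
      assume "r \<in> N"
      moreover from this have "\<phi> r < \<phi> b" using qr(4) by (auto simp: N_def)
      ultimately show False using min[of r] by simp
    qed
    then have "r = \<zero>\<^bsub>R\<^esub> \<or> r \<in> Units R" using qr by (auto simp: N_def)
    then have "\<exists>c \<in> carrier F. r = \<kappa> c"
      using \<kappa>.hom_zero by (metis unit_is_const zero_closed)
    then show ?thesis using qr by blast
  qed
  obtain q c where qc: "q \<in> carrier R" "c \<in> carrier F" "\<pi> X = b \<otimes>\<^bsub>R\<^esub> q \<oplus>\<^bsub>R\<^esub> \<kappa> c"
    using const[of "\<pi> X"] by auto
  obtain r d where rd: "r \<in> carrier R" "d \<in> carrier F" "y = b \<otimes>\<^bsub>R\<^esub> r \<oplus>\<^bsub>R\<^esub> \<kappa> d"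
    using const[of y] by auto
  define k where "k = c \<otimes> c \<oplus> d \<otimes> d \<oplus> \<one>"
  have k: "k \<in> carrier F" "k \<noteq> \<zero>" using two_squares_neq qc rd by (simp_all add: k_def)
  define c' d' where "c' = \<kappa> c" and "d' = \<kappa> d"
  have cR: "c' \<in> carrier R" and dR: "d' \<in> carrier R" using qc rd by (simp_all add: c'_def d'_def)
  define x where "x = \<pi> X"
  have xR: "x \<in> carrier R" and yR: "y \<in> carrier R" by (simp_all add: x_def)
  have br: "b \<otimes>\<^bsub>R\<^esub> r = y \<ominus>\<^bsub>R\<^esub> d'" and bq: "b \<otimes>\<^bsub>R\<^esub> q = x \<ominus>\<^bsub>R\<^esub> c'"
    unfolding rd(3) x_def qc(3) d'_def[symmetric] c'_def[symmetric]
    using qc(1) rd(1) bR(1) cR dR by (simp_all add: a_minus_def R.a_assoc R.r_neg)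
  \<comment> \<open>With \<open>b r = y - d\<close> and \<open>b q = x - c\<close>, the product \<open>b z\<close> is \<open>(d\<^sup>2 - y\<^sup>2) + (c\<^sup>2 - x\<^sup>2)\<close>.\<close>
  define z where "z = \<ominus>\<^bsub>R\<^esub> (r \<otimes>\<^bsub>R\<^esub> (y \<oplus>\<^bsub>R\<^esub> d') \<oplus>\<^bsub>R\<^esub> q \<otimes>\<^bsub>R\<^esub> (x \<oplus>\<^bsub>R\<^esub> c'))"
  have z: "z \<in> carrier R" using qc(1) rd(1) xR yR cR dR by (simp add: z_def)
  have "b \<otimes>\<^bsub>R\<^esub> z = \<ominus>\<^bsub>R\<^esub> ((b \<otimes>\<^bsub>R\<^esub> r) \<otimes>\<^bsub>R\<^esub> (y \<oplus>\<^bsub>R\<^esub> d') \<oplus>\<^bsub>R\<^esub> (b \<otimes>\<^bsub>R\<^esub> q) \<otimes>\<^bsub>R\<^esub> (x \<oplus>\<^bsub>R\<^esub> c'))"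
    unfolding z_def using qc(1) rd(1) bR(1) cR dR xR yR by algebra
  also have "\<dots> = c' \<otimes>\<^bsub>R\<^esub> c' \<oplus>\<^bsub>R\<^esub> d' \<otimes>\<^bsub>R\<^esub> d' \<oplus>\<^bsub>R\<^esub> \<one>\<^bsub>R\<^esub> \<ominus>\<^bsub>R\<^esub> (y \<otimes>\<^bsub>R\<^esub> y \<oplus>\<^bsub>R\<^esub> (x \<otimes>\<^bsub>R\<^esub> x \<oplus>\<^bsub>R\<^esub> \<one>\<^bsub>R\<^esub>))"
    unfolding br bq using cR dR xR yR by algebra
  also have "y \<otimes>\<^bsub>R\<^esub> y \<oplus>\<^bsub>R\<^esub> (x \<otimes>\<^bsub>R\<^esub> x \<oplus>\<^bsub>R\<^esub> \<one>\<^bsub>R\<^esub>) = \<zero>\<^bsub>R\<^esub>"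
    unfolding x_def by (rule conic_eq)
  finally have "b \<otimes>\<^bsub>R\<^esub> z = \<kappa> k" using qc rd by (simp add: c'_def d'_def k_def)
  then have "b \<otimes>\<^bsub>R\<^esub> (z \<otimes>\<^bsub>R\<^esub> \<kappa> (inv k)) = \<one>\<^bsub>R\<^esub>"
    using \<kappa>_inv[OF k] k z bR by (simp add: R.m_assoc[symmetric])
  then have "b divides\<^bsub>R\<^esub> \<one>\<^bsub>R\<^esub>" using z k by (auto simp: factor_def intro!: bexI[of _ "z \<otimes>\<^bsub>R\<^esub> \<kappa> (inv k)"])
  then show False using R.divides_one bR by blast
qed

section \<open>The coordinate ring is principal\<close>

text \<open>If the quotient by \<open>l\<close> is spanned over \<open>F\<close> by \<open>1\<close> and \<open>j\<close>, with \<open>j\<^sup>2 = -e\<close>, and the form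
\<open>c\<^sup>2 + d\<^sup>2 e\<close> is anisotropic over \<open>F\<close>, then every nonzero residue has an invertible norm.\<close>

lemma generates_maximalI:
  assumes l: "l \<in> carrier R" and j: "j \<in> carrier R" and e: "e \<in> carrier F"
    and je: "l divides\<^bsub>R\<^esub> (j \<otimes>\<^bsub>R\<^esub> j \<oplus>\<^bsub>R\<^esub> \<kappa> e)"
    and red: "\<And>f. f \<in> carrier R \<Longrightarrow> \<exists>c \<in> carrier F. \<exists>d \<in> carrier F. \<exists>r \<in> carrier R.
      f = \<kappa> c \<oplus>\<^bsub>R\<^esub> \<kappa> d \<otimes>\<^bsub>R\<^esub> j \<oplus>\<^bsub>R\<^esub> l \<otimes>\<^bsub>R\<^esub> r"
    and aniso: "\<And>c d. \<lbrakk>c \<in> carrier F; d \<in> carrier F; c \<otimes> c \<oplus> d \<otimes> d \<otimes> e = \<zero>\<rbrakk>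
      \<Longrightarrow> c = \<zero> \<and> d = \<zero>"
  shows "R.generates_maximal l"
  unfolding R.generates_maximal_def
proof (intro conjI ballI)
  fix f assume "f \<in> carrier R"
  then obtain c d r where cdr: "c \<in> carrier F" "d \<in> carrier F" "r \<in> carrier R"
      "f = \<kappa> c \<oplus>\<^bsub>R\<^esub> \<kappa> d \<otimes>\<^bsub>R\<^esub> j \<oplus>\<^bsub>R\<^esub> l \<otimes>\<^bsub>R\<^esub> r"
    using red by blast
  obtain s where s: "s \<in> carrier R" "j \<otimes>\<^bsub>R\<^esub> j \<oplus>\<^bsub>R\<^esub> \<kappa> e = l \<otimes>\<^bsub>R\<^esub> s"
    using je by (auto simp: factor_def)
  define k where "k = c \<otimes> c \<oplus> d \<otimes> d \<otimes> e"
  have k: "k \<in> carrier F" using cdr e by (simp add: k_def)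
  show "l divides\<^bsub>R\<^esub> f \<or> (\<exists>g \<in> carrier R. \<exists>r \<in> carrier R. f \<otimes>\<^bsub>R\<^esub> g \<oplus>\<^bsub>R\<^esub> l \<otimes>\<^bsub>R\<^esub> r = \<one>\<^bsub>R\<^esub>)"
  proof (cases "k = \<zero>")
    case True
    then have "c = \<zero> \<and> d = \<zero>" using aniso cdr(1,2) by (simp add: k_def)
    then have "f = l \<otimes>\<^bsub>R\<^esub> r" using cdr l j by simp
    then show ?thesis using cdr(3) by (auto simp: factor_def)
  next
    case False
    have "(\<kappa> c \<otimes>\<^bsub>R\<^esub> \<kappa> c \<oplus>\<^bsub>R\<^esub> \<kappa> d \<otimes>\<^bsub>R\<^esub> \<kappa> d \<otimes>\<^bsub>R\<^esub> \<kappa> e) \<otimes>\<^bsub>R\<^esub> \<kappa> (inv k) = \<one>\<^bsub>R\<^esub>"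
      using \<kappa>_inv[OF k False] cdr e by (simp add: k_def)
    from R.norm_form_inverse[OF \<kappa>.hom_closed[OF cdr(1)] \<kappa>.hom_closed[OF cdr(2)]
        \<kappa>.hom_closed[OF e] \<kappa>.hom_closed[OF inv_closed[OF k False]] j l cdr(3) s(1) s(2) this]
    have "f \<otimes>\<^bsub>R\<^esub> ((\<kappa> c \<ominus>\<^bsub>R\<^esub> \<kappa> d \<otimes>\<^bsub>R\<^esub> j) \<otimes>\<^bsub>R\<^esub> \<kappa> (inv k)) \<oplus>\<^bsub>R\<^esub>
      l \<otimes>\<^bsub>R\<^esub> ((\<kappa> d \<otimes>\<^bsub>R\<^esub> \<kappa> d \<otimes>\<^bsub>R\<^esub> s \<ominus>\<^bsub>R\<^esub> r \<otimes>\<^bsub>R\<^esub> (\<kappa> c \<ominus>\<^bsub>R\<^esub> \<kappa> d \<otimes>\<^bsub>R\<^esub> j)) \<otimes>\<^bsub>R\<^esub> \<kappa> (inv k)) = \<one>\<^bsub>R\<^esub>"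
      unfolding cdr(4) .
    moreover have "(\<kappa> c \<ominus>\<^bsub>R\<^esub> \<kappa> d \<otimes>\<^bsub>R\<^esub> j) \<otimes>\<^bsub>R\<^esub> \<kappa> (inv k) \<in> carrier R"
      "(\<kappa> d \<otimes>\<^bsub>R\<^esub> \<kappa> d \<otimes>\<^bsub>R\<^esub> s \<ominus>\<^bsub>R\<^esub> r \<otimes>\<^bsub>R\<^esub> (\<kappa> c \<ominus>\<^bsub>R\<^esub> \<kappa> d \<otimes>\<^bsub>R\<^esub> j)) \<otimes>\<^bsub>R\<^esub> \<kappa> (inv k) \<in> carrier R"
      using cdr e k False s j by simp_all
    ultimately show ?thesis by blast
  qed
qed (rule l)

text \<open>Modulo \<open>x - s\<close> the ring is spanned by \<open>1\<close> and \<open>y\<close>, with \<open>y\<^sup>2 = -(1 + s\<^sup>2)\<close>. The form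
\<open>c\<^sup>2 + d\<^sup>2 (1 + s\<^sup>2)\<close> is again a sum of three squares.\<close>

lemma lin_generates_maximal:
  assumes s: "s \<in> carrier F"
  shows "R.generates_maximal (\<pi> (lin s))"
proof (rule generates_maximalI[where j = y and e = "\<one> \<oplus> s \<otimes> s"])
  define x s' where "x = \<pi> X" and "s' = \<kappa> s"
  have xR: "x \<in> carrier R" and sR: "s' \<in> carrier R" and yR: "y \<in> carrier R"
    using s by (simp_all add: x_def s'_def)
  have l: "\<pi> (lin s) = x \<ominus>\<^bsub>R\<^esub> s'"
    using s by (simp add: x_def s'_def \<kappa>_def a_minus_def)
  have "y \<otimes>\<^bsub>R\<^esub> y \<oplus>\<^bsub>R\<^esub> (\<one>\<^bsub>R\<^esub> \<oplus>\<^bsub>R\<^esub> s' \<otimes>\<^bsub>R\<^esub> s') =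
      (x \<ominus>\<^bsub>R\<^esub> s') \<otimes>\<^bsub>R\<^esub> (\<ominus>\<^bsub>R\<^esub> (x \<oplus>\<^bsub>R\<^esub> s')) \<oplus>\<^bsub>R\<^esub> (y \<otimes>\<^bsub>R\<^esub> y \<oplus>\<^bsub>R\<^esub> (x \<otimes>\<^bsub>R\<^esub> x \<oplus>\<^bsub>R\<^esub> \<one>\<^bsub>R\<^esub>))"
    using xR sR yR by algebra
  also have "y \<otimes>\<^bsub>R\<^esub> y \<oplus>\<^bsub>R\<^esub> (x \<otimes>\<^bsub>R\<^esub> x \<oplus>\<^bsub>R\<^esub> \<one>\<^bsub>R\<^esub>) = \<zero>\<^bsub>R\<^esub>"
    using conic_eq by (simp add: x_def)
  finally have "y \<otimes>\<^bsub>R\<^esub> y \<oplus>\<^bsub>R\<^esub> \<kappa> (\<one> \<oplus> s \<otimes> s) = \<pi> (lin s) \<otimes>\<^bsub>R\<^esub> (\<ominus>\<^bsub>R\<^esub> (x \<oplus>\<^bsub>R\<^esub> s'))"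
    unfolding l using s xR sR by (simp add: s'_def)
  then show "\<pi> (lin s) divides\<^bsub>R\<^esub> (y \<otimes>\<^bsub>R\<^esub> y \<oplus>\<^bsub>R\<^esub> \<kappa> (\<one> \<oplus> s \<otimes> s))"
    using xR sR by (auto simp: factor_def)
  have red: "\<exists>c \<in> carrier F. \<exists>r \<in> carrier R. \<pi> a = \<kappa> c \<oplus>\<^bsub>R\<^esub> \<pi> (lin s) \<otimes>\<^bsub>R\<^esub> r" if a: "a \<in> carrier P" for a
  proof -
    have d: "degree (lin s) = 1" "lin s \<in> carrier P" using degree_lin lin_closed s by blast+
    then have "lin s \<noteq> \<zero>\<^bsub>P\<^esub>" by (intro not_zero_if_degree) simp
    then obtain q r where qr: "q \<in> carrier P" "r \<in> carrier P" "a = lin s \<otimes>\<^bsub>P\<^esub> q \<oplus>\<^bsub>P\<^esub> r"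
        "r = \<zero>\<^bsub>P\<^esub> \<or> degree r < degree (lin s)"
      using subfield_long_division_theorem_shell[OF carrier_is_subfield a d(2)] by blast
    have "degree r = 0" using qr(4) unfolding d(1) by (auto simp: univ_poly_zero)
    then have "r \<in> poly_of_const ` carrier F" using qr(2) by (simp add: poly_of_const_over_carrier)
    then obtain c where c: "c \<in> carrier F" "r = poly_of_const c" by blast
    have "\<pi> a = \<pi> (lin s) \<otimes>\<^bsub>R\<^esub> \<pi> q \<oplus>\<^bsub>R\<^esub> \<kappa> c"
      unfolding qr(3) c(2) \<kappa>_def
      by (simp only: \<pi>.hom_add[OF P.m_closed[OF d(2) qr(1)] const.hom_closed[OF c(1)]] \<pi>.hom_mult[OF d(2) qr(1)])
    also have "\<dots> = \<kappa> c \<oplus>\<^bsub>R\<^esub> \<pi> (lin s) \<otimes>\<^bsub>R\<^esub> \<pi> q"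
      using d(2) qr(1) c(1) by (intro R.a_comm R.m_closed \<pi>.hom_closed \<kappa>.hom_closed)
    finally show ?thesis using c(1) \<pi>.hom_closed[OF qr(1)] by blast
  qed
  fix f assume "f \<in> carrier R"
  then obtain a b where ab: "a \<in> carrier P" "b \<in> carrier P" "f = \<pi> a \<oplus>\<^bsub>R\<^esub> \<pi> b \<otimes>\<^bsub>R\<^esub> y" using span by blast
  define l where "l = \<pi> (lin s)"
  have lR: "l \<in> carrier R" using lin_closed[OF s] by (simp add: l_def)
  obtain c r where cr: "c \<in> carrier F" "r \<in> carrier R" "\<pi> a = \<kappa> c \<oplus>\<^bsub>R\<^esub> l \<otimes>\<^bsub>R\<^esub> r"
    using red[OF ab(1)] unfolding l_def by blast
  obtain d r' where dr: "d \<in> carrier F" "r' \<in> carrier R" "\<pi> b = \<kappa> d \<oplus>\<^bsub>R\<^esub> l \<otimes>\<^bsub>R\<^esub> r'"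
    using red[OF ab(2)] unfolding l_def by blast
  define c' d' where "c' = \<kappa> c" and "d' = \<kappa> d"
  have cR: "c' \<in> carrier R" and dR: "d' \<in> carrier R" using cr dr by (simp_all add: c'_def d'_def)
  have "(c' \<oplus>\<^bsub>R\<^esub> l \<otimes>\<^bsub>R\<^esub> r) \<oplus>\<^bsub>R\<^esub> (d' \<oplus>\<^bsub>R\<^esub> l \<otimes>\<^bsub>R\<^esub> r') \<otimes>\<^bsub>R\<^esub> y =
      c' \<oplus>\<^bsub>R\<^esub> d' \<otimes>\<^bsub>R\<^esub> y \<oplus>\<^bsub>R\<^esub> l \<otimes>\<^bsub>R\<^esub> (r \<oplus>\<^bsub>R\<^esub> r' \<otimes>\<^bsub>R\<^esub> y)"
    using lR cR dR cr(2) dr(2) yR by algebra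
  then have "f = \<kappa> c \<oplus>\<^bsub>R\<^esub> \<kappa> d \<otimes>\<^bsub>R\<^esub> y \<oplus>\<^bsub>R\<^esub> \<pi> (lin s) \<otimes>\<^bsub>R\<^esub> (r \<oplus>\<^bsub>R\<^esub> r' \<otimes>\<^bsub>R\<^esub> y)"
    unfolding ab(3) cr(3) dr(3) c'_def d'_def l_def .
  then show "\<exists>c \<in> carrier F. \<exists>d \<in> carrier F. \<exists>r \<in> carrier R.
      f = \<kappa> c \<oplus>\<^bsub>R\<^esub> \<kappa> d \<otimes>\<^bsub>R\<^esub> y \<oplus>\<^bsub>R\<^esub> \<pi> (lin s) \<otimes>\<^bsub>R\<^esub> r"
    using cr(1,2) dr(1,2) yR R.a_closed[OF cr(2) R.m_closed[OF dr(2) yR]] by blast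
next
  fix c d assume cd: "c \<in> carrier F" "d \<in> carrier F" "c \<otimes> c \<oplus> d \<otimes> d \<otimes> (\<one> \<oplus> s \<otimes> s) = \<zero>"
  have "c \<otimes> c \<oplus> d \<otimes> d \<oplus> (d \<otimes> s) \<otimes> (d \<otimes> s) = c \<otimes> c \<oplus> d \<otimes> d \<otimes> (\<one> \<oplus> s \<otimes> s)"
    using cd(1,2) s by algebra
  then show "c = \<zero> \<and> d = \<zero>"
    using three_squares_eq_zero[of c d "d \<otimes> s"] cd s by simp
next
  show "\<pi> (lin s) \<in> carrier R" by (rule \<pi>.hom_closed[OF lin_closed[OF s]])
  show "\<one> \<oplus> s \<otimes> s \<in> carrier F" using s by simp
qed (rule y_closed)

text \<open>The element \<open>j = (x - s)/t\<close> satisfies \<open>t\<^sup>2 (j\<^sup>2 + 1) = (x - s)\<^sup>2 + t\<^sup>2\<close>, and \<open>j\<^sup>2 + 1\<close> is a unit times \<open>l l'\<close>.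
Hence \<open>j\<^sup>2 = -1\<close> modulo \<open>l\<close>; the quadratic vanishes there, and the quotient by \<open>l\<close> is spanned by \<open>1\<close> and \<open>j\<close>:
a copy of \<open>F(i)\<close>.\<close>

lemma line_generates_maximal:
  assumes F: "s \<in> carrier F" "t \<in> carrier F" "m \<in> carrier F" "n \<in> carrier F" and t: "t \<noteq> \<zero>"
    and re: "s \<otimes> s \<oplus> \<one> \<oplus> m \<otimes> m = t \<otimes> t \<oplus> n \<otimes> n"
    and im: "m \<otimes> n \<oplus> m \<otimes> n \<oplus> (s \<otimes> t \<oplus> s \<otimes> t) = \<zero>"
    and j: "j = (\<pi> X \<ominus>\<^bsub>R\<^esub> \<kappa> s) \<otimes>\<^bsub>R\<^esub> \<kappa> (inv t)"
    and l: "l = y \<oplus>\<^bsub>R\<^esub> (\<kappa> m \<oplus>\<^bsub>R\<^esub> \<kappa> n \<otimes>\<^bsub>R\<^esub> j)"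
    and l': "l' = y \<ominus>\<^bsub>R\<^esub> (\<kappa> m \<oplus>\<^bsub>R\<^esub> \<kappa> n \<otimes>\<^bsub>R\<^esub> j)"
  shows "R.generates_maximal l" and "l \<noteq> \<zero>\<^bsub>R\<^esub>"
    and "l \<otimes>\<^bsub>R\<^esub> l' = \<pi> (quad s t) \<otimes>\<^bsub>R\<^esub> \<kappa> (\<ominus> ((t \<otimes> t \<oplus> n \<otimes> n) \<otimes> (inv t \<otimes> inv t)))"
proof -
  define x S T V M N where "x = \<pi> X" and "S = \<kappa> s" and "T = \<kappa> t" and "V = \<kappa> (inv t)"
    and "M = \<kappa> m" and "N = \<kappa> n"
  have it: "inv t \<in> carrier F" using F t by simp
  have xR: "x \<in> carrier R" and SR: "S \<in> carrier R" and TR: "T \<in> carrier R" and VR: "V \<in> carrier R"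
    and MR: "M \<in> carrier R" and NR: "N \<in> carrier R" and yR: "y \<in> carrier R"
    using F t it by (simp_all add: x_def S_def T_def V_def M_def N_def)
  have jR: "j \<in> carrier R" using xR SR VR by (simp add: j x_def S_def V_def)
  have lR: "l \<in> carrier R" "l' \<in> carrier R" using yR MR NR jR by (simp_all add: l l' M_def N_def)
  have TV: "T \<otimes>\<^bsub>R\<^esub> V = \<one>\<^bsub>R\<^esub>" using \<kappa>_inv F t by (simp add: T_def V_def)
  have x_eq: "x = S \<oplus>\<^bsub>R\<^esub> T \<otimes>\<^bsub>R\<^esub> j"
  proof -
    have "S \<oplus>\<^bsub>R\<^esub> T \<otimes>\<^bsub>R\<^esub> ((x \<ominus>\<^bsub>R\<^esub> S) \<otimes>\<^bsub>R\<^esub> V) = S \<oplus>\<^bsub>R\<^esub> (x \<ominus>\<^bsub>R\<^esub> S) \<otimes>\<^bsub>R\<^esub> (T \<otimes>\<^bsub>R\<^esub> V)"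
      using xR SR TR VR by algebra
    also have "\<dots> = S \<oplus>\<^bsub>R\<^esub> (x \<ominus>\<^bsub>R\<^esub> S)" unfolding TV using xR SR by simp
    also have "\<dots> = x" using xR SR by algebra
    finally show ?thesis by (simp add: j x_def S_def V_def)
  qed
  have quad: "\<pi> (quad s t) = T \<otimes>\<^bsub>R\<^esub> T \<otimes>\<^bsub>R\<^esub> (j \<otimes>\<^bsub>R\<^esub> j \<oplus>\<^bsub>R\<^esub> \<one>\<^bsub>R\<^esub>)"
  proof -
    have "\<pi> (lin s) = x \<ominus>\<^bsub>R\<^esub> S"
      using F by (simp add: x_def S_def \<kappa>_def a_minus_def)
    then have "\<pi> (quad s t) = (x \<ominus>\<^bsub>R\<^esub> S) \<otimes>\<^bsub>R\<^esub> (x \<ominus>\<^bsub>R\<^esub> S) \<oplus>\<^bsub>R\<^esub> T \<otimes>\<^bsub>R\<^esub> T"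
      unfolding T_def \<kappa>_def using lin_closed[OF F(1)] const.hom_closed[OF F(2)]
      by (metis P.m_closed \<pi>.hom_add \<pi>.hom_mult)
    also have "\<dots> = ((S \<oplus>\<^bsub>R\<^esub> T \<otimes>\<^bsub>R\<^esub> j) \<ominus>\<^bsub>R\<^esub> S) \<otimes>\<^bsub>R\<^esub> ((S \<oplus>\<^bsub>R\<^esub> T \<otimes>\<^bsub>R\<^esub> j) \<ominus>\<^bsub>R\<^esub> S) \<oplus>\<^bsub>R\<^esub> T \<otimes>\<^bsub>R\<^esub> T"
      unfolding x_eq ..
    also have "\<dots> = T \<otimes>\<^bsub>R\<^esub> T \<otimes>\<^bsub>R\<^esub> (j \<otimes>\<^bsub>R\<^esub> j \<oplus>\<^bsub>R\<^esub> \<one>\<^bsub>R\<^esub>)"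
      using SR TR jR by algebra
    finally show ?thesis .
  qed
  define k where "k = t \<otimes> t \<oplus> n \<otimes> n"
  have k: "k \<in> carrier F" using F by (simp add: k_def)
  \<comment> \<open>As \<open>t \<noteq> 0\<close>, the factor \<open>t\<^sup>2 + n\<^sup>2\<close> is invertible.\<close>
  have k0: "k \<noteq> \<zero>"
    using three_squares_eq_zero[of n \<zero> t] F t by (auto simp: k_def a_comm)
  have ll': "l \<otimes>\<^bsub>R\<^esub> l' = \<ominus>\<^bsub>R\<^esub> (\<kappa> k \<otimes>\<^bsub>R\<^esub> (j \<otimes>\<^bsub>R\<^esub> j \<oplus>\<^bsub>R\<^esub> \<one>\<^bsub>R\<^esub>))"
  proof -
    have "S \<otimes>\<^bsub>R\<^esub> S \<oplus>\<^bsub>R\<^esub> \<one>\<^bsub>R\<^esub> \<oplus>\<^bsub>R\<^esub> M \<otimes>\<^bsub>R\<^esub> M = T \<otimes>\<^bsub>R\<^esub> T \<oplus>\<^bsub>R\<^esub> N \<otimes>\<^bsub>R\<^esub> N"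
      using arg_cong[OF re, of \<kappa>] F by (simp add: S_def T_def M_def N_def)
    moreover have "M \<otimes>\<^bsub>R\<^esub> N \<oplus>\<^bsub>R\<^esub> M \<otimes>\<^bsub>R\<^esub> N \<oplus>\<^bsub>R\<^esub> (S \<otimes>\<^bsub>R\<^esub> T \<oplus>\<^bsub>R\<^esub> S \<otimes>\<^bsub>R\<^esub> T) = \<zero>\<^bsub>R\<^esub>"
      using arg_cong[OF im, of \<kappa>] F by (simp add: S_def T_def M_def N_def)
    moreover have "y \<otimes>\<^bsub>R\<^esub> y \<oplus>\<^bsub>R\<^esub> ((S \<oplus>\<^bsub>R\<^esub> T \<otimes>\<^bsub>R\<^esub> j) \<otimes>\<^bsub>R\<^esub> (S \<oplus>\<^bsub>R\<^esub> T \<otimes>\<^bsub>R\<^esub> j) \<oplus>\<^bsub>R\<^esub> \<one>\<^bsub>R\<^esub>) = \<zero>\<^bsub>R\<^esub>"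
      using conic_eq unfolding x_eq[symmetric] x_def .
    ultimately have "(y \<oplus>\<^bsub>R\<^esub> (M \<oplus>\<^bsub>R\<^esub> N \<otimes>\<^bsub>R\<^esub> j)) \<otimes>\<^bsub>R\<^esub> (y \<ominus>\<^bsub>R\<^esub> (M \<oplus>\<^bsub>R\<^esub> N \<otimes>\<^bsub>R\<^esub> j)) =
        \<ominus>\<^bsub>R\<^esub> ((T \<otimes>\<^bsub>R\<^esub> T \<oplus>\<^bsub>R\<^esub> N \<otimes>\<^bsub>R\<^esub> N) \<otimes>\<^bsub>R\<^esub> (j \<otimes>\<^bsub>R\<^esub> j \<oplus>\<^bsub>R\<^esub> \<one>\<^bsub>R\<^esub>))"
      by (intro R.line_pair_product[OF yR SR TR MR NR jR])
    moreover have "T \<otimes>\<^bsub>R\<^esub> T \<oplus>\<^bsub>R\<^esub> N \<otimes>\<^bsub>R\<^esub> N = \<kappa> k" using F by (simp add: T_def N_def k_def)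
    ultimately show ?thesis by (simp add: l l' M_def N_def)
  qed
  define u where "u = j \<otimes>\<^bsub>R\<^esub> j \<oplus>\<^bsub>R\<^esub> \<one>\<^bsub>R\<^esub>"
  have uR: "u \<in> carrier R" using jR by (simp add: u_def)
  define K where "K = \<kappa> k"
  have KR: "K \<in> carrier R" using k by (simp add: K_def)
  show "l \<otimes>\<^bsub>R\<^esub> l' = \<pi> (quad s t) \<otimes>\<^bsub>R\<^esub> \<kappa> (\<ominus> ((t \<otimes> t \<oplus> n \<otimes> n) \<otimes> (inv t \<otimes> inv t)))"
  proof -
    have "T \<otimes>\<^bsub>R\<^esub> T \<otimes>\<^bsub>R\<^esub> u \<otimes>\<^bsub>R\<^esub> (\<ominus>\<^bsub>R\<^esub> (K \<otimes>\<^bsub>R\<^esub> (V \<otimes>\<^bsub>R\<^esub> V))) =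
        \<ominus>\<^bsub>R\<^esub> (K \<otimes>\<^bsub>R\<^esub> u \<otimes>\<^bsub>R\<^esub> (T \<otimes>\<^bsub>R\<^esub> V) \<otimes>\<^bsub>R\<^esub> (T \<otimes>\<^bsub>R\<^esub> V))"
      using TR VR uR KR by algebra
    also have "\<dots> = \<ominus>\<^bsub>R\<^esub> (K \<otimes>\<^bsub>R\<^esub> u)" unfolding TV using KR uR by simp
    finally show ?thesis
      unfolding ll' quad k_def[symmetric] u_def[symmetric] K_def[symmetric]
      using k it by (simp add: K_def V_def)
  qed
  define k' where "k' = l' \<otimes>\<^bsub>R\<^esub> (\<ominus>\<^bsub>R\<^esub> \<kappa> (inv k))"
  have k'R: "k' \<in> carrier R" using lR k k0 by (simp add: k'_def)
  have u_eq: "u = l \<otimes>\<^bsub>R\<^esub> k'"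
  proof -
    define W where "W = \<kappa> (inv k)"
    have WR: "W \<in> carrier R" and KW: "K \<otimes>\<^bsub>R\<^esub> W = \<one>\<^bsub>R\<^esub>" using \<kappa>_inv[OF k k0] k k0 by (simp_all add: W_def K_def)
    have "l \<otimes>\<^bsub>R\<^esub> k' = (l \<otimes>\<^bsub>R\<^esub> l') \<otimes>\<^bsub>R\<^esub> (\<ominus>\<^bsub>R\<^esub> W)"
      using lR WR by (simp add: k'_def W_def R.m_assoc)
    also have "\<dots> = \<ominus>\<^bsub>R\<^esub> (K \<otimes>\<^bsub>R\<^esub> u) \<otimes>\<^bsub>R\<^esub> (\<ominus>\<^bsub>R\<^esub> W)" unfolding ll' u_def K_def ..
    also have "\<dots> = u \<otimes>\<^bsub>R\<^esub> (K \<otimes>\<^bsub>R\<^esub> W)"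
      using KR uR WR by algebra
    also have "\<dots> = u" unfolding KW using uR by simp
    finally show ?thesis ..
  qed
  show "l \<noteq> \<zero>\<^bsub>R\<^esub>"
  proof
    assume "l = \<zero>\<^bsub>R\<^esub>"
    \<comment> \<open>The coefficient of \<open>y\<close> in \<open>l\<close> is \<open>1\<close>, so \<open>l\<close> is nonzero by independence.\<close>
    define a where "a = poly_of_const m \<oplus>\<^bsub>P\<^esub> poly_of_const n \<otimes>\<^bsub>P\<^esub> ((X \<ominus>\<^bsub>P\<^esub> poly_of_const s) \<otimes>\<^bsub>P\<^esub> poly_of_const (inv t))"
    have a: "a \<in> carrier P" using F it by (simp add: a_def)
    have "\<pi> a = \<kappa> m \<oplus>\<^bsub>R\<^esub> \<kappa> n \<otimes>\<^bsub>R\<^esub> j"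
      using F it by (simp add: a_def j \<kappa>_def a_minus_def)
    then have "\<pi> a \<oplus>\<^bsub>R\<^esub> \<pi> \<one>\<^bsub>P\<^esub> \<otimes>\<^bsub>R\<^esub> y = l"
      using MR NR jR yR by (simp add: l M_def N_def R.a_comm)
    then show False using indep[OF a P.one_closed] \<open>l = \<zero>\<^bsub>R\<^esub>\<close> by simp
  qed
  have red: "\<exists>c \<in> carrier F. \<exists>d \<in> carrier F. \<exists>r \<in> carrier R. \<pi> a = \<kappa> c \<oplus>\<^bsub>R\<^esub> \<kappa> d \<otimes>\<^bsub>R\<^esub> j \<oplus>\<^bsub>R\<^esub> l \<otimes>\<^bsub>R\<^esub> r"
    if a: "a \<in> carrier P" for a
  proof -
    have d: "degree (quad s t) = 2" "quad s t \<in> carrier P" using degree_quad F by simp_all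
    then have "quad s t \<noteq> \<zero>\<^bsub>P\<^esub>" by (intro not_zero_if_degree) simp
    then obtain q r where qr: "q \<in> carrier P" "r \<in> carrier P" "a = quad s t \<otimes>\<^bsub>P\<^esub> q \<oplus>\<^bsub>P\<^esub> r"
        "r = \<zero>\<^bsub>P\<^esub> \<or> degree r < degree (quad s t)"
      using subfield_long_division_theorem_shell[OF carrier_is_subfield a d(2)] by blast
    have "length r \<le> 2" using qr(4) unfolding d(1) by (auto simp: univ_poly_zero)
    then obtain c e where ce: "c \<in> carrier F" "e \<in> carrier F"
        "r = poly_of_const c \<oplus>\<^bsub>P\<^esub> poly_of_const e \<otimes>\<^bsub>P\<^esub> X"
      using length_le_2_linear qr(2) by blast
    define C E q' where "C = \<kappa> c" and "E = \<kappa> e" and "q' = \<pi> q"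
    have CR: "C \<in> carrier R" and ER: "E \<in> carrier R" and qR: "q' \<in> carrier R"
      using ce qr by (simp_all add: C_def E_def q'_def)
    have "\<pi> r = C \<oplus>\<^bsub>R\<^esub> E \<otimes>\<^bsub>R\<^esub> x"
      unfolding ce(3) using ce(1,2) by (simp add: C_def E_def x_def \<kappa>_def)
    moreover have "\<pi> a = \<pi> (quad s t) \<otimes>\<^bsub>R\<^esub> q' \<oplus>\<^bsub>R\<^esub> \<pi> r"
      unfolding qr(3) q'_def using \<pi>.hom_add[OF P.m_closed[OF d(2) qr(1)] qr(2)] \<pi>.hom_mult[OF d(2) qr(1)] by metis
    ultimately have "\<pi> a = T \<otimes>\<^bsub>R\<^esub> T \<otimes>\<^bsub>R\<^esub> (l \<otimes>\<^bsub>R\<^esub> k') \<otimes>\<^bsub>R\<^esub> q' \<oplus>\<^bsub>R\<^esub> (C \<oplus>\<^bsub>R\<^esub> E \<otimes>\<^bsub>R\<^esub> (S \<oplus>\<^bsub>R\<^esub> T \<otimes>\<^bsub>R\<^esub> j))"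
      unfolding quad u_eq[unfolded u_def] x_eq by simp
    also have "\<dots> = (C \<oplus>\<^bsub>R\<^esub> E \<otimes>\<^bsub>R\<^esub> S) \<oplus>\<^bsub>R\<^esub> (E \<otimes>\<^bsub>R\<^esub> T) \<otimes>\<^bsub>R\<^esub> j \<oplus>\<^bsub>R\<^esub> l \<otimes>\<^bsub>R\<^esub> (T \<otimes>\<^bsub>R\<^esub> T \<otimes>\<^bsub>R\<^esub> k' \<otimes>\<^bsub>R\<^esub> q')"
      using TR lR(1) k'R qR CR ER SR jR by algebra
    also have "C \<oplus>\<^bsub>R\<^esub> E \<otimes>\<^bsub>R\<^esub> S = \<kappa> (c \<oplus> e \<otimes> s)" using F ce(1,2) by (simp add: C_def E_def S_def)
    also have "E \<otimes>\<^bsub>R\<^esub> T = \<kappa> (e \<otimes> t)" using F ce(1,2) by (simp add: E_def T_def)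
    finally have "\<pi> a = \<kappa> (c \<oplus> e \<otimes> s) \<oplus>\<^bsub>R\<^esub> \<kappa> (e \<otimes> t) \<otimes>\<^bsub>R\<^esub> j \<oplus>\<^bsub>R\<^esub>
      l \<otimes>\<^bsub>R\<^esub> (T \<otimes>\<^bsub>R\<^esub> T \<otimes>\<^bsub>R\<^esub> k' \<otimes>\<^bsub>R\<^esub> q')" .
    moreover have "c \<oplus> e \<otimes> s \<in> carrier F" "e \<otimes> t \<in> carrier F"
      "T \<otimes>\<^bsub>R\<^esub> T \<otimes>\<^bsub>R\<^esub> k' \<otimes>\<^bsub>R\<^esub> q' \<in> carrier R"
      using ce(1,2) F TR k'R qR by simp_all
    ultimately show ?thesis by blast
  qed
  show "R.generates_maximal l"
  proof (rule generates_maximalI[OF lR(1) jR one_closed])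
    show "l divides\<^bsub>R\<^esub> (j \<otimes>\<^bsub>R\<^esub> j \<oplus>\<^bsub>R\<^esub> \<kappa> \<one>)"
      using u_eq k'R by (auto simp: factor_def u_def)
    fix f assume "f \<in> carrier R"
    then obtain a b where ab: "a \<in> carrier P" "b \<in> carrier P" "f = \<pi> a \<oplus>\<^bsub>R\<^esub> \<pi> b \<otimes>\<^bsub>R\<^esub> y" using span by blast
    obtain c d r where c: "c \<in> carrier F" "d \<in> carrier F" "r \<in> carrier R"
        "\<pi> a = \<kappa> c \<oplus>\<^bsub>R\<^esub> \<kappa> d \<otimes>\<^bsub>R\<^esub> j \<oplus>\<^bsub>R\<^esub> l \<otimes>\<^bsub>R\<^esub> r"
      using red[OF ab(1)] by blast
    obtain c' d' r' where c': "c' \<in> carrier F" "d' \<in> carrier F" "r' \<in> carrier R"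
        "\<pi> b = \<kappa> c' \<oplus>\<^bsub>R\<^esub> \<kappa> d' \<otimes>\<^bsub>R\<^esub> j \<oplus>\<^bsub>R\<^esub> l \<otimes>\<^bsub>R\<^esub> r'"
      using red[OF ab(2)] by blast
    have "f = (\<kappa> c \<ominus>\<^bsub>R\<^esub> \<kappa> c' \<otimes>\<^bsub>R\<^esub> M \<oplus>\<^bsub>R\<^esub> \<kappa> d' \<otimes>\<^bsub>R\<^esub> N) \<oplus>\<^bsub>R\<^esub>
        (\<kappa> d \<ominus>\<^bsub>R\<^esub> \<kappa> c' \<otimes>\<^bsub>R\<^esub> N \<ominus>\<^bsub>R\<^esub> \<kappa> d' \<otimes>\<^bsub>R\<^esub> M) \<otimes>\<^bsub>R\<^esub> j \<oplus>\<^bsub>R\<^esub>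
        l \<otimes>\<^bsub>R\<^esub> (r \<oplus>\<^bsub>R\<^esub> r' \<otimes>\<^bsub>R\<^esub> y \<oplus>\<^bsub>R\<^esub> \<kappa> c' \<oplus>\<^bsub>R\<^esub> \<kappa> d' \<otimes>\<^bsub>R\<^esub> j \<ominus>\<^bsub>R\<^esub> \<kappa> d' \<otimes>\<^bsub>R\<^esub> N \<otimes>\<^bsub>R\<^esub> k')"
      unfolding ab(3) c(4) c'(4)
      by (rule R.reduce_modulo_line[OF _ _ c(3) _ _ c'(3) MR NR jR lR(1) k'R yR])
        (use c c' u_eq in \<open>simp_all add: u_def l M_def N_def\<close>)
    also have "\<kappa> c \<ominus>\<^bsub>R\<^esub> \<kappa> c' \<otimes>\<^bsub>R\<^esub> M \<oplus>\<^bsub>R\<^esub> \<kappa> d' \<otimes>\<^bsub>R\<^esub> N = \<kappa> (c \<ominus> c' \<otimes> m \<oplus> d' \<otimes> n)"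
      using c c' F by (simp add: M_def N_def a_minus_def)
    also have "\<kappa> d \<ominus>\<^bsub>R\<^esub> \<kappa> c' \<otimes>\<^bsub>R\<^esub> N \<ominus>\<^bsub>R\<^esub> \<kappa> d' \<otimes>\<^bsub>R\<^esub> M = \<kappa> (d \<ominus> c' \<otimes> n \<ominus> d' \<otimes> m)"
      using c c' F by (simp add: M_def N_def a_minus_def)
    finally have "f = \<kappa> (c \<ominus> c' \<otimes> m \<oplus> d' \<otimes> n) \<oplus>\<^bsub>R\<^esub> \<kappa> (d \<ominus> c' \<otimes> n \<ominus> d' \<otimes> m) \<otimes>\<^bsub>R\<^esub> j \<oplus>\<^bsub>R\<^esub>
        l \<otimes>\<^bsub>R\<^esub> (r \<oplus>\<^bsub>R\<^esub> r' \<otimes>\<^bsub>R\<^esub> y \<oplus>\<^bsub>R\<^esub> \<kappa> c' \<oplus>\<^bsub>R\<^esub> \<kappa> d' \<otimes>\<^bsub>R\<^esub> j \<ominus>\<^bsub>R\<^esub> \<kappa> d' \<otimes>\<^bsub>R\<^esub> N \<otimes>\<^bsub>R\<^esub> k')" .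
    moreover have "c \<ominus> c' \<otimes> m \<oplus> d' \<otimes> n \<in> carrier F" "d \<ominus> c' \<otimes> n \<ominus> d' \<otimes> m \<in> carrier F"
      "r \<oplus>\<^bsub>R\<^esub> r' \<otimes>\<^bsub>R\<^esub> y \<oplus>\<^bsub>R\<^esub> \<kappa> c' \<oplus>\<^bsub>R\<^esub> \<kappa> d' \<otimes>\<^bsub>R\<^esub> j \<ominus>\<^bsub>R\<^esub> \<kappa> d' \<otimes>\<^bsub>R\<^esub> N \<otimes>\<^bsub>R\<^esub> k' \<in> carrier R"
      using c c' F jR k'R NR by simp_all
    ultimately show "\<exists>c \<in> carrier F. \<exists>d \<in> carrier F. \<exists>r \<in> carrier R.
        f = \<kappa> c \<oplus>\<^bsub>R\<^esub> \<kappa> d \<otimes>\<^bsub>R\<^esub> j \<oplus>\<^bsub>R\<^esub> l \<otimes>\<^bsub>R\<^esub> r"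
      by blast
  next
    fix c d assume "c \<in> carrier F" "d \<in> carrier F" "c \<otimes> c \<oplus> d \<otimes> d \<otimes> \<one> = \<zero>"
    then show "c = \<zero> \<and> d = \<zero>" using three_squares_eq_zero[of c d \<zero>] by simp
  qed
qed

text \<open>Both lines through the quadratic are instances of the preceding lemma, for the square roots \<open>m + n i\<close> and
\<open>-m - n i\<close>.\<close>

lemma quad_times_forces_principal:
  assumes F: "s \<in> carrier F" "t \<in> carrier F" and t: "t \<noteq> \<zero>"
    and g: "g \<in> carrier R" "R.forces_principal g"
  shows "R.forces_principal (\<pi> (quad s t) \<otimes>\<^bsub>R\<^esub> g)"
proof -
  obtain m n where mn: "m \<in> carrier F" "n \<in> carrier F"
    and sq: "m \<otimes> m \<ominus> n \<otimes> n = \<ominus> (\<one> \<oplus> s \<otimes> s \<ominus> t \<otimes> t)" "m \<otimes> n \<oplus> m \<otimes> n = \<ominus> (s \<otimes> t \<oplus> s \<otimes> t)"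
    using exists_complex_sqrt[of "\<ominus> (\<one> \<oplus> s \<otimes> s \<ominus> t \<otimes> t)" "\<ominus> (s \<otimes> t \<oplus> s \<otimes> t)"] F by auto
  have im: "m \<otimes> n \<oplus> m \<otimes> n \<oplus> (s \<otimes> t \<oplus> s \<otimes> t) = \<zero>"
    unfolding sq(2) using F by (intro l_neg) simp
  have "s \<otimes> s \<oplus> \<one> \<oplus> m \<otimes> m \<ominus> (t \<otimes> t \<oplus> n \<otimes> n) =
      (m \<otimes> m \<ominus> n \<otimes> n) \<oplus> (\<one> \<oplus> s \<otimes> s \<ominus> t \<otimes> t)"
    using mn F by algebra
  also have "\<dots> = \<zero>" unfolding sq(1) using F by (intro l_neg) simp
  finally have re: "s \<otimes> s \<oplus> \<one> \<oplus> m \<otimes> m = t \<otimes> t \<oplus> n \<otimes> n"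
    by (rule eq_if_diff_eq_zero[rotated 2]) (use mn F in simp_all)
  define m' n' where "m' = \<ominus> m" and "n' = \<ominus> n"
  have mn': "m' \<in> carrier F" "n' \<in> carrier F" using mn by (simp_all add: m'_def n'_def)
  have "m' \<otimes> m' = m \<otimes> m" "m' \<otimes> n' = m \<otimes> n" "n' \<otimes> n' = n \<otimes> n"
    unfolding m'_def n'_def using mn by (simp_all add: l_minus r_minus)
  then have re': "s \<otimes> s \<oplus> \<one> \<oplus> m' \<otimes> m' = t \<otimes> t \<oplus> n' \<otimes> n'"
    and im': "m' \<otimes> n' \<oplus> m' \<otimes> n' \<oplus> (s \<otimes> t \<oplus> s \<otimes> t) = \<zero>"
    using re im by simp_all
  define j where "j = (\<pi> X \<ominus>\<^bsub>R\<^esub> \<kappa> s) \<otimes>\<^bsub>R\<^esub> \<kappa> (inv t)"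
  have j: "j \<in> carrier R" using F t by (simp add: j_def)
  define b where "b = \<kappa> m \<oplus>\<^bsub>R\<^esub> \<kappa> n \<otimes>\<^bsub>R\<^esub> j"
  have b: "b \<in> carrier R" using mn j by (simp add: b_def)
  have b': "\<kappa> m' \<oplus>\<^bsub>R\<^esub> \<kappa> n' \<otimes>\<^bsub>R\<^esub> j = \<ominus>\<^bsub>R\<^esub> b"
    using mn j by (simp add: b_def m'_def n'_def R.l_minus R.minus_add)
  define l l' where "l = y \<oplus>\<^bsub>R\<^esub> b" and "l' = y \<ominus>\<^bsub>R\<^esub> b"
  have lR: "l \<in> carrier R" "l' \<in> carrier R" using b by (simp_all add: l_def l'_def)
  define c where "c = \<kappa> (\<ominus> ((t \<otimes> t \<oplus> n \<otimes> n) \<otimes> (inv t \<otimes> inv t)))"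
  have c: "c \<in> carrier R" using F t mn by (simp add: c_def)
  have l: "R.generates_maximal l" "l \<noteq> \<zero>\<^bsub>R\<^esub>" "l \<otimes>\<^bsub>R\<^esub> l' = \<pi> (quad s t) \<otimes>\<^bsub>R\<^esub> c"
    unfolding c_def
    by (rule line_generates_maximal[OF F mn t re im j_def l_def[unfolded b_def] l'_def[unfolded b_def]])+
  have l'_eq: "l' = y \<oplus>\<^bsub>R\<^esub> (\<kappa> m' \<oplus>\<^bsub>R\<^esub> \<kappa> n' \<otimes>\<^bsub>R\<^esub> j)"
    unfolding b' l'_def a_minus_def ..
  have l': "R.generates_maximal l'" "l' \<noteq> \<zero>\<^bsub>R\<^esub>"
    by (rule line_generates_maximal[OF F mn' t re' im' j_def l'_eq refl])+
  have quad: "\<pi> (quad s t) \<in> carrier R"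
    using lin_closed[OF F(1)] const.hom_closed[OF F(2)] by (intro \<pi>.hom_closed P.a_closed P.m_closed)
  have "R.forces_principal (l \<otimes>\<^bsub>R\<^esub> (l' \<otimes>\<^bsub>R\<^esub> g))"
    using l l' g lR by (intro R.forces_principal_mult R.m_closed)
  also have "l \<otimes>\<^bsub>R\<^esub> (l' \<otimes>\<^bsub>R\<^esub> g) = (\<pi> (quad s t) \<otimes>\<^bsub>R\<^esub> c) \<otimes>\<^bsub>R\<^esub> g"
    unfolding l(3)[symmetric] by (rule R.m_assoc[OF lR g(1), symmetric])
  also have "\<dots> = (\<pi> (quad s t) \<otimes>\<^bsub>R\<^esub> g) \<otimes>\<^bsub>R\<^esub> c"
    using quad c g(1) by (metis R.m_assoc R.m_comm)
  finally show ?thesis using c by (rule R.forces_principal_factor)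
qed

text \<open>Induction on the degree: split off a linear or quadratic factor, which in the coordinate ring is a
product of at most two generators of maximal ideals, up to a unit.\<close>

lemma \<pi>_forces_principal:
  assumes "p \<in> carrier P" "p \<noteq> \<zero>\<^bsub>P\<^esub>"
  shows "R.forces_principal (\<pi> p)"
  using assms
proof (induction "degree p" arbitrary: p rule: less_induct)
  case less
  show ?case
  proof (cases "degree p = 0")
    case True
    then have "p \<in> poly_of_const ` carrier F"
      using less.prems(1) by (simp add: poly_of_const_over_carrier)
    then obtain c where c: "c \<in> carrier F" "\<pi> p = \<kappa> c" by (auto simp: \<kappa>_def)
    have "\<pi> p \<noteq> \<zero>\<^bsub>R\<^esub>" using \<pi>_eq_zeroD less.prems by blast
    then have "c \<noteq> \<zero>" using c by auto
    then have "\<pi> p \<otimes>\<^bsub>R\<^esub> \<kappa> (inv c) = \<one>\<^bsub>R\<^esub>" "\<kappa> (inv c) \<in> carrier R"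
      using \<kappa>_inv c by simp_all
    then show ?thesis using R.forces_principal_factor R.forces_principal_one by metis
  next
    case False
    have smaller: "R.forces_principal (\<pi> q) \<and> \<pi> q \<in> carrier R"
      if d: "d \<in> carrier P" "degree d > 0" and q: "q \<in> carrier P" and pdq: "p = d \<otimes>\<^bsub>P\<^esub> q" for d q
    proof -
      have "q \<noteq> \<zero>\<^bsub>P\<^esub>" using less.prems(2) d(1) unfolding pdq by auto
      moreover have "degree q < degree p"
        unfolding pdq degree_mult[OF d(1) q not_zero_if_degree[OF d(2)] \<open>q \<noteq> \<zero>\<^bsub>P\<^esub>\<close>] using d(2) by simp
      ultimately show ?thesis using less.hyps q \<pi>.hom_closed by blast
    qed
    have "degree p > 0" using False by simp
    from linear_or_quadratic_factor[OF less.prems(1) this] show ?thesis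
    proof (elim disjE bexE)
      fix s q assume s: "s \<in> carrier F" and q: "q \<in> carrier P" and p: "p = lin s \<otimes>\<^bsub>P\<^esub> q"
      have d: "degree (lin s) > 0" using degree_lin[OF s] by linarith
      have "\<pi> (lin s) \<noteq> \<zero>\<^bsub>R\<^esub>"
        using \<pi>_eq_zeroD[OF lin_closed[OF s]] not_zero_if_degree[OF d] by blast
      then have "R.forces_principal (\<pi> (lin s) \<otimes>\<^bsub>R\<^esub> \<pi> q)"
        using lin_generates_maximal[OF s] smaller[OF lin_closed[OF s] d q p]
        by (intro R.forces_principal_mult) auto
      then show ?thesis unfolding p \<pi>.hom_mult[OF lin_closed[OF s] q] .
    next
      fix s t q assume s: "s \<in> carrier F" and t: "t \<in> carrier F - {\<zero>}" and q: "q \<in> carrier P"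
        and p: "p = quad s t \<otimes>\<^bsub>P\<^esub> q"
      have t': "t \<in> carrier F" "t \<noteq> \<zero>" using t by auto
      have closed: "quad s t \<in> carrier P"
        using lin_closed[OF s] const.hom_closed[OF t'(1)] by (intro P.a_closed P.m_closed)
      have d: "degree (quad s t) > 0" using degree_quad[OF s t'(1)] by linarith
      have "R.forces_principal (\<pi> (quad s t) \<otimes>\<^bsub>R\<^esub> \<pi> q)"
        using smaller[OF closed d q p] by (intro quad_times_forces_principal s t') auto
      then show ?thesis unfolding p \<pi>.hom_mult[OF closed q] .
    qed
  qed
qed

text \<open>A nonzero element divides its norm, which is a nonzero element of \<open>F[X]\<close>.\<close>

lemma principal: "principal_domain R"
proof (rule R.principal_domainI)
  fix f assume f: "f \<in> carrier R" "f \<noteq> \<zero>\<^bsub>R\<^esub>"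
  obtain a b where ab: "a \<in> carrier P" "b \<in> carrier P" "f = \<pi> a \<oplus>\<^bsub>R\<^esub> \<pi> b \<otimes>\<^bsub>R\<^esub> y"
    using span[OF f(1)] by blast
  have "norm_form a b \<noteq> \<zero>\<^bsub>P\<^esub>"
    using norm_form_eq_zeroD[OF ab(1,2)] f(2) unfolding ab(3) by auto
  then have "R.forces_principal (\<pi> (norm_form a b))"
    using ab(1,2) by (intro \<pi>_forces_principal P.conic_norm_form_closed X_closed)
  then show "R.forces_principal f"
    unfolding \<pi>_norm_form[OF ab(1,2)] ab(3)[symmetric]
    by (rule R.forces_principal_factor) (use ab(1,2) in simp)
qed

end

section \<open>The quotient of the bivariate polynomial ring\<close>

context formally_real_field
begin

text \<open>As a polynomial in the outer variable, the conic is \<open>Y\<^sup>2 + (X\<^sup>2 + 1)\<close>: monic, so that division with remainder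
by it is possible although \<open>F[X]\<close> is not a field.\<close>

lemma conic_poly_monic:
  shows "conic_poly F \<in> carrier (poly_ring P)" "degree (conic_poly F) = 2" "lead_coeff (conic_poly F) = \<one>\<^bsub>P\<^esub>"
proof -
  interpret S: domain "poly_ring P" by (rule P.univ_poly_is_domain[OF P.carrier_is_subring])
  interpret c: ring_hom_ring P "poly_ring P" P.poly_of_const
    using P.canonical_embedding_ring_hom[OF P.carrier_is_subring] by simp
  define u where "u = X [^]\<^bsub>P\<^esub> (2::nat) \<oplus>\<^bsub>P\<^esub> \<one>\<^bsub>P\<^esub>"
  have u: "u \<in> carrier P" by (simp add: u_def)
  define Y2 where "Y2 = X\<^bsub>P\<^esub> [^]\<^bsub>poly_ring P\<^esub> (2::nat)"
  have Y2: "Y2 \<in> carrier (poly_ring P)" by (simp add: Y2_def)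
  have Y2_eq: "Y2 = [\<one>\<^bsub>P\<^esub>, \<zero>\<^bsub>P\<^esub>, \<zero>\<^bsub>P\<^esub>]"
    using P.unitary_monom_eq_var_pow[OF P.carrier_is_subring, of 2]
    by (simp add: Y2_def P.monom_def numeral_2_eq_2)
  define v where "v = P.poly_of_const (X [^]\<^bsub>P\<^esub> (2::nat))"
  have v: "v \<in> carrier (poly_ring P)" by (simp add: v_def)
  have "P.poly_of_const u = v \<oplus>\<^bsub>poly_ring P\<^esub> \<one>\<^bsub>poly_ring P\<^esub>"
    by (simp add: u_def v_def)
  moreover have "conic_poly F = v \<oplus>\<^bsub>poly_ring P\<^esub> Y2 \<oplus>\<^bsub>poly_ring P\<^esub> \<one>\<^bsub>poly_ring P\<^esub>"
    unfolding conic_poly_def poly_ring2_def var1_def var2_def Y2_def v_def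
    by (simp add: c.hom_nat_pow)
  ultimately have eq: "conic_poly F = Y2 \<oplus>\<^bsub>poly_ring P\<^esub> P.poly_of_const u"
    using v Y2 by (simp add: S.a_ac)
  show "conic_poly F \<in> carrier (poly_ring P)" unfolding eq using Y2 u by simp
  show deg: "degree (conic_poly F) = 2"
    unfolding eq P.degree_add_const[OF Y2 c.hom_closed[OF u] P.degree_const] by (simp add: Y2_eq)
  have "lead_coeff (conic_poly F) = P.coeff (conic_poly F) 2"
    using deg P.lead_coeff_simp[of "conic_poly F"] by fastforce
  also have "\<dots> = P.coeff Y2 2 \<oplus>\<^bsub>P\<^esub> P.coeff (P.poly_of_const u) 2"
  proof -
    have "set Y2 \<subseteq> carrier P" "set (P.poly_of_const u) \<subseteq> carrier P"
      using Y2 c.hom_closed[OF u] P.polynomial_in_carrier[OF P.carrier_is_subring]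
      by (simp_all add: univ_poly_carrier)
    then show ?thesis
      unfolding eq univ_poly_add[of P] by (rule P.poly_add_coeff[THEN fun_cong])
  qed
  also have "P.coeff (P.poly_of_const u) 2 = \<zero>\<^bsub>P\<^esub>"
    using P.degree_const[of u] by (intro P.coeff_degree) linarith
  also have "P.coeff Y2 2 = \<one>\<^bsub>P\<^esub>" by (simp add: Y2_eq)
  finally show "lead_coeff (conic_poly F) = \<one>\<^bsub>P\<^esub>" by simp
qed

lemma linear_eq_zeroD:
  assumes "a \<in> carrier P" "b \<in> carrier P"
    and eq: "P.poly_of_const a \<oplus>\<^bsub>poly_ring P\<^esub> P.poly_of_const b \<otimes>\<^bsub>poly_ring P\<^esub> X\<^bsub>P\<^esub> = \<zero>\<^bsub>poly_ring P\<^esub>"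
  shows "a = \<zero>\<^bsub>P\<^esub> \<and> b = \<zero>\<^bsub>P\<^esub>"
proof -
  interpret S: domain "poly_ring P" by (rule P.univ_poly_is_domain[OF P.carrier_is_subring])
  interpret c: ring_hom_ring P "poly_ring P" P.poly_of_const
    using P.canonical_embedding_ring_hom[OF P.carrier_is_subring] by simp
  interpret ev: ring_hom_ring "poly_ring P" P "\<lambda>p. P.eval p \<zero>\<^bsub>P\<^esub>"
    by (rule P.eval_ring_hom[OF P.carrier_is_subring P.zero_closed])
  have ev_const: "P.eval (P.poly_of_const k) \<zero>\<^bsub>P\<^esub> = k" if "k \<in> carrier P" for k
    using that by (auto simp: P.poly_of_const_def)
  \<comment> \<open>Setting the outer variable to zero isolates the constant term.\<close>
  have "P.eval X\<^bsub>P\<^esub> \<zero>\<^bsub>P\<^esub> = \<zero>\<^bsub>P\<^esub>" by (rule P.eval_var[OF P.zero_closed])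
  then have a: "a = \<zero>\<^bsub>P\<^esub>"
    using arg_cong[OF eq, of "\<lambda>p. P.eval p \<zero>\<^bsub>P\<^esub>"] assms(1,2) by (simp add: ev_const)
  then have "P.poly_of_const b \<otimes>\<^bsub>poly_ring P\<^esub> X\<^bsub>P\<^esub> = \<zero>\<^bsub>poly_ring P\<^esub>" using eq assms(2) by simp
  moreover have "X\<^bsub>P\<^esub> \<noteq> \<zero>\<^bsub>poly_ring P\<^esub>" using P.degree_X by (intro P.not_zero_if_degree) simp
  ultimately have "P.poly_of_const b = \<zero>\<^bsub>poly_ring P\<^esub>"
    using S.integral[OF _ c.hom_closed[OF assms(2)] P.X_closed] by blast
  then have "b = \<zero>\<^bsub>P\<^esub>" using ev_const[OF assms(2)] ev.hom_zero by simp
  then show ?thesis using a by blast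
qed

end

text \<open>Remainders modulo a monic polynomial of degree two are linear, which gives the spanning property;
nonzero multiples of it have degree at least two, which gives independence.\<close>

lemma (in real_closed_field) conic_ring_presentation:
  "\<exists>\<pi> y. conic_presentation F (conic_ring F) \<pi> y"
proof -
  interpret S: domain "poly_ring P" by (rule P.univ_poly_is_domain[OF P.carrier_is_subring])
  interpret c: ring_hom_ring P "poly_ring P" P.poly_of_const
    using P.canonical_embedding_ring_hom[OF P.carrier_is_subring] by simp
  define m where "m = conic_poly F"
  have m: "m \<in> carrier (poly_ring P)" "degree m = 2" "lead_coeff m = \<one>\<^bsub>P\<^esub>"
    using conic_poly_monic by (simp_all add: m_def)
  have R_eq: "conic_ring F = Rupt\<^bsub>P\<^esub> (carrier P) m"
    by (simp add: conic_ring_def rupture_def poly_ring2_def m_def)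
  define h where "h = P.rupture_surj (carrier P) m"
  interpret h: ring_hom_ring "poly_ring P" "conic_ring F" h
    unfolding R_eq h_def by (rule P.rupture_surj_hom(2)[OF P.carrier_is_subring m(1)])
  have R: "cring (conic_ring F)"
    unfolding R_eq rupture_def
    by (rule ideal.quotient_is_cring[OF S.cgenideal_ideal[OF m(1)] S.is_cring])
  define \<pi> where "\<pi> = h \<circ> P.poly_of_const"
  have \<pi>: "ring_hom_ring P (conic_ring F) \<pi>"
    unfolding \<pi>_def
    by (rule ring_hom_ringI2[OF P.ring_axioms h.S.ring_axioms ring_hom_trans[OF c.homh h.homh]])
  have hm: "h m = \<zero>\<^bsub>conic_ring F\<^esub>"
    unfolding h_def R_eq by (rule P.rupture_surj_self[OF m(1)])
  define y where "y = h X\<^bsub>P\<^esub>"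
  have lin: "\<pi> a \<oplus>\<^bsub>conic_ring F\<^esub> \<pi> b \<otimes>\<^bsub>conic_ring F\<^esub> y =
      h (P.poly_of_const a \<oplus>\<^bsub>poly_ring P\<^esub> P.poly_of_const b \<otimes>\<^bsub>poly_ring P\<^esub> X\<^bsub>P\<^esub>)"
    if "a \<in> carrier P" "b \<in> carrier P" for a b
    using that by (simp add: \<pi>_def y_def)
  have "conic_presentation F (conic_ring F) \<pi> y"
  proof (intro conic_presentation.intro conic_presentation_axioms.intro real_closed_field_axioms R \<pi>)
    show "y \<in> carrier (conic_ring F)" by (simp add: y_def)
  next
    have yR: "y \<in> carrier (conic_ring F)" and xR: "\<pi> X \<in> carrier (conic_ring F)"
      by (simp_all add: y_def \<pi>_def)
    have "h m = \<pi> X \<otimes>\<^bsub>conic_ring F\<^esub> \<pi> X \<oplus>\<^bsub>conic_ring F\<^esub> y \<otimes>\<^bsub>conic_ring F\<^esub> y \<oplus>\<^bsub>conic_ring F\<^esub> \<one>\<^bsub>conic_ring F\<^esub>"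
      unfolding m_def conic_poly_def poly_ring2_def var1_def var2_def
      by (simp add: \<pi>_def y_def numeral_2_eq_2)
    then show "y \<otimes>\<^bsub>conic_ring F\<^esub> y \<oplus>\<^bsub>conic_ring F\<^esub>
        (\<pi> X \<otimes>\<^bsub>conic_ring F\<^esub> \<pi> X \<oplus>\<^bsub>conic_ring F\<^esub> \<one>\<^bsub>conic_ring F\<^esub>) = \<zero>\<^bsub>conic_ring F\<^esub>"
      using hm yR xR by (simp add: h.S.a_ac)
  next
    fix f assume "f \<in> carrier (conic_ring F)"
    then obtain p where p: "p \<in> carrier (poly_ring P)" "f = h p"
      unfolding R_eq h_def rupture_def FactRing_def A_RCOSETS_def' by auto
    have "m \<noteq> []" using m(2) by auto
    moreover have "\<one>\<^bsub>P\<^esub> \<in> Units (P \<lparr> carrier := carrier P \<rparr>)" by simp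
    ultimately obtain q r where qr: "q \<in> carrier (poly_ring P)" "r \<in> carrier (poly_ring P)"
        "p = m \<otimes>\<^bsub>poly_ring P\<^esub> q \<oplus>\<^bsub>poly_ring P\<^esub> r" "r = [] \<or> degree r < degree m"
      using P.long_division_theorem[OF P.carrier_is_subring, of p m] p(1) m
      by (auto simp: univ_poly_carrier)
    have "length r \<le> 2" using qr(4) m(2) by auto
    then obtain a b where ab: "a \<in> carrier P" "b \<in> carrier P"
        "r = P.poly_of_const a \<oplus>\<^bsub>poly_ring P\<^esub> P.poly_of_const b \<otimes>\<^bsub>poly_ring P\<^esub> X\<^bsub>P\<^esub>"
      using P.length_le_2_linear[OF qr(2)] by blast
    have "f = h r" using p(2) qr(1-3) m(1) hm by simp
    then show "\<exists>a \<in> carrier P. \<exists>b \<in> carrier P. f = \<pi> a \<oplus>\<^bsub>conic_ring F\<^esub> \<pi> b \<otimes>\<^bsub>conic_ring F\<^esub> y"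
      using lin[OF ab(1,2)] ab by auto
  next
    fix a b assume ab: "a \<in> carrier P" "b \<in> carrier P"
      and eq: "\<pi> a \<oplus>\<^bsub>conic_ring F\<^esub> \<pi> b \<otimes>\<^bsub>conic_ring F\<^esub> y = \<zero>\<^bsub>conic_ring F\<^esub>"
    define r where "r = P.poly_of_const a \<oplus>\<^bsub>poly_ring P\<^esub> P.poly_of_const b \<otimes>\<^bsub>poly_ring P\<^esub> X\<^bsub>P\<^esub>"
    have r: "r \<in> carrier (poly_ring P)" using ab by (simp add: r_def)
    have "h r = \<zero>\<^bsub>conic_ring F\<^esub>" using eq lin[OF ab] by (simp add: r_def)
    then obtain q where q: "q \<in> carrier (poly_ring P)" "r = q \<otimes>\<^bsub>poly_ring P\<^esub> m"
      using P.rupture_surj_eq_zeroD[OF m(1) r] unfolding R_eq h_def by blast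
    have "degree r \<le> 1"
    proof -
      define bX where "bX = P.poly_of_const b \<otimes>\<^bsub>poly_ring P\<^esub> X\<^bsub>P\<^esub>"
      have bX: "bX \<in> carrier (poly_ring P)" using ab by (simp add: bX_def)
      have "degree bX = (if P.poly_of_const b = [] \<or> X\<^bsub>P\<^esub> = [] then 0
          else degree (P.poly_of_const b) + degree X\<^bsub>P\<^esub>)"
        unfolding bX_def univ_poly_mult[of P]
        using c.hom_closed[OF ab(2)] P.X_closed
        by (intro P.poly_mult_degree_eq[OF P.carrier_is_subring]) (simp_all add: univ_poly_carrier)
      then have "degree bX \<le> 1"
        unfolding P.degree_const P.degree_X by (simp only: simp_thms add_0 le_refl zero_le split: if_splits)
      moreover have "degree r = degree (bX \<oplus>\<^bsub>poly_ring P\<^esub> P.poly_of_const a)"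
        using S.a_comm[OF bX c.hom_closed[OF ab(1)]] by (simp add: r_def bX_def)
      moreover have "degree (bX \<oplus>\<^bsub>poly_ring P\<^esub> P.poly_of_const a) = degree bX"
        by (rule P.degree_add_const[OF bX c.hom_closed[OF ab(1)] P.degree_const])
      ultimately show ?thesis by linarith
    qed
    moreover have m0: "m \<noteq> \<zero>\<^bsub>poly_ring P\<^esub>" using m(2) by (intro P.not_zero_if_degree) simp
    ultimately have "q = \<zero>\<^bsub>poly_ring P\<^esub>"
      using P.degree_mult[OF q(1) m(1) _ m0] m(2) unfolding q(2) by fastforce
    then have "r = \<zero>\<^bsub>poly_ring P\<^esub>" using q(2) m(1) by simp
    then show "a = \<zero>\<^bsub>P\<^esub> \<and> b = \<zero>\<^bsub>P\<^esub>" using linear_eq_zeroD[OF ab] by (simp add: r_def)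
  qed
  then show ?thesis by blast
qed

theorem theorem7:
  fixes F :: "('a, 'b) ring_scheme" (structure)
  assumes "real_closed_field F"
  shows "principal_domain (conic_ring F) \<and> \<not> (\<exists>\<phi>. euclidean_domain (conic_ring F) \<phi>)"
proof -
  interpret real_closed_field F by (rule assms)
  obtain \<pi> y where "conic_presentation F (conic_ring F) \<pi> y"
    using conic_ring_presentation by blast
  then interpret conic_presentation F "conic_ring F" \<pi> y .
  show ?thesis using principal not_euclidean by blast
qed

end
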